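(* Let $G$ be a graph on $[n]$ that is closed with respect to its given labelling of vertices. Then $\mathrm{in}_\tau(\mathcal{R}(J_G))=\mathcal{R}(\mathrm{in}_\sigma(J_G))$ and the relation type of $J_G$ is at most $2$. Moreover, the set $\{x_i,y_i:1\le i\le n\}\cup\{f_et:e\in E(G)\}$ is a Sagbi basis of $\mathcal{R}(J_G)$ with respect to $\tau$.
   Context: Graphs are finite and simple. $S=\mathbb{K}[x_1,\ldots,x_n,y_1,\ldots,y_n]$, and for $e=\{i,j\}\in E(G)$ with $i<j$, $f_e=x_iy_j-x_jy_i$; $J_G=(f_e:e\in E(G))$. $\sigma$ is the lexicographic order induced by $x_1>\cdots>x_n>y_1>\cdots>y_n$; $G$ is closed with respect to the given labelling if $\{f_e\}$ is a Gröbner basis of $J_G$ w.r.t. $\sigma$. The Rees algebra is $\mathcal{R}(I)=\bigoplus_{k\ge0}I^kt^k\subset S[t]$. The term order $\tau$ on $S[t]$: for monomials $u,v\in S$ and $i,j\ge0$, $ut^i<_\tau vt^j$ iff $i<j$, or $i=j$ and $u<_\sigma v$. For a $\mathbb{K}$-subalgebra $A$ of a polynomial ring, the initial algebra $\mathrm{in}_\tau(A)$ is the $\mathbb{K}$-algebra generated by $\{\mathrm{in}_\tau(f):f\in A\}$, and a subset $B\subset A$ is a Sagbi basis if $\{\mathrm{in}_\tau(b):b\in B\}$ generates $\mathrm{in}_\tau(A)$ as a $\mathbb{K}$-algebra. Writing $\mathcal{R}(I)\cong R/\ker\psi$ with $R=S[t_1,\ldots,t_m]$, $\psi(t_i)=f_it$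 for minimal generators $f_i$ of $I$, the relation type of $I$ is the largest $t$-degree of a minimal generator of $\ker\psi$. *)

theory Defs
  imports Main "HOL-Library.Poly_Mapping"
begin

type_synonym ('v, 'k) mpoly = "('v \<Rightarrow>\<^sub>0 nat) \<Rightarrow>\<^sub>0 'k"

definition Var :: "'v \<Rightarrow> ('v, 'k::comm_ring_1) mpoly" where
  "Var v = Poly_Mapping.single (Poly_Mapping.single v 1) 1"

definition Const :: "'k \<Rightarrow> ('v, 'k::comm_ring_1) mpoly" where
  "Const c = Poly_Mapping.single 0 c"

definition polys_in :: "'v set \<Rightarrow> ('v, 'k::comm_ring_1) mpoly set" where
  "polys_in V = {f :: ('v, 'k) mpoly. \<forall>m \<in> Poly_Mapping.keys f. Poly_Mapping.keys m \<subseteq> V}"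

inductive_set ideal_gen :: "('v, 'k::comm_ring_1) mpoly set \<Rightarrow> ('v, 'k) mpoly set \<Rightarrow> ('v, 'k) mpoly set"
  for R B where
  zero: "0 \<in> ideal_gen R B"
| gen: "b \<in> B \<Longrightarrow> b \<in> ideal_gen R B"
| add: "a \<in> ideal_gen R B \<Longrightarrow> c \<in> ideal_gen R B \<Longrightarrow> a + c \<in> ideal_gen R B"
| mult: "r \<in> R \<Longrightarrow> a \<in> ideal_gen R B \<Longrightarrow> r * a \<in> ideal_gen R B"

inductive_set alg_gen :: "('v, 'k::comm_ring_1) mpoly set \<Rightarrow> ('v, 'k) mpoly set"
  for B where
  const: "Const c \<in> alg_gen B"
| gen: "b \<in> B \<Longrightarrow> b \<in> alg_gen B"
| add: "a \<in> alg_gen B \<Longrightarrow> c \<in> alg_gen B \<Longrightarrow> a + c \<in> alg_gen B"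
| mult: "a \<in> alg_gen B \<Longrightarrow> c \<in> alg_gen B \<Longrightarrow> a * c \<in> alg_gen B"

definition lex_less :: "('v \<Rightarrow> 'v \<Rightarrow> bool) \<Rightarrow> ('v \<Rightarrow>\<^sub>0 nat) \<Rightarrow> ('v \<Rightarrow>\<^sub>0 nat) \<Rightarrow> bool" where
  "lex_less gt a b \<longleftrightarrow>
     (\<exists>v. Poly_Mapping.lookup a v < Poly_Mapping.lookup b v \<and> (\<forall>w. gt w v \<longrightarrow> Poly_Mapping.lookup a w = Poly_Mapping.lookup b w))"

definition lead_mon :: "(('v \<Rightarrow>\<^sub>0 nat) \<Rightarrow> ('v \<Rightarrow>\<^sub>0 nat) \<Rightarrow> bool) \<Rightarrow> ('v, 'k::comm_ring_1) mpoly \<Rightarrow> ('v \<Rightarrow>\<^sub>0 nat)" where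
  "lead_mon ordlt f = (THE m. m \<in> Poly_Mapping.keys f \<and> (\<forall>m' \<in> Poly_Mapping.keys f. m' \<noteq> m \<longrightarrow> ordlt m' m))"

definition init :: "(('v \<Rightarrow>\<^sub>0 nat) \<Rightarrow> ('v \<Rightarrow>\<^sub>0 nat) \<Rightarrow> bool) \<Rightarrow> ('v, 'k::comm_ring_1) mpoly \<Rightarrow> ('v, 'k) mpoly" where
  "init ordlt f = Poly_Mapping.single (lead_mon ordlt f) (Poly_Mapping.lookup f (lead_mon ordlt f))"

definition init_ideal :: "(('v \<Rightarrow>\<^sub>0 nat) \<Rightarrow> ('v \<Rightarrow>\<^sub>0 nat) \<Rightarrow> bool) \<Rightarrow> ('v, 'k::comm_ring_1) mpoly set
     \<Rightarrow> ('v, 'k) mpoly set \<Rightarrow> ('v, 'k) mpoly set" where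
  "init_ideal ordlt R I = ideal_gen R {init ordlt f | f. f \<in> I \<and> f \<noteq> 0}"

definition is_groebner_basis :: "(('v \<Rightarrow>\<^sub>0 nat) \<Rightarrow> ('v \<Rightarrow>\<^sub>0 nat) \<Rightarrow> bool) \<Rightarrow> ('v, 'k::comm_ring_1) mpoly set
     \<Rightarrow> ('v, 'k) mpoly set \<Rightarrow> bool" where
  "is_groebner_basis ordlt R F \<longleftrightarrow>
     ideal_gen R (init ordlt ` F) = init_ideal ordlt R (ideal_gen R F)"

definition init_alg :: "(('v \<Rightarrow>\<^sub>0 nat) \<Rightarrow> ('v \<Rightarrow>\<^sub>0 nat) \<Rightarrow> bool) \<Rightarrow> ('v, 'k::comm_ring_1) mpoly set \<Rightarrow> ('v, 'k) mpoly set" where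
  "init_alg ordlt A = alg_gen {init ordlt f | f. f \<in> A \<and> f \<noteq> 0}"

definition is_sagbi_basis :: "(('v \<Rightarrow>\<^sub>0 nat) \<Rightarrow> ('v \<Rightarrow>\<^sub>0 nat) \<Rightarrow> bool) \<Rightarrow> ('v, 'k::comm_ring_1) mpoly set
     \<Rightarrow> ('v, 'k) mpoly set \<Rightarrow> bool" where
  "is_sagbi_basis ordlt A B \<longleftrightarrow> B \<subseteq> A \<and> alg_gen (init ordlt ` B) = init_alg ordlt A"

datatype var = X nat | Y nat | T

definition S_vars :: "nat \<Rightarrow> var set" where
  "S_vars n = X ` {1..n} \<union> Y ` {1..n}"

definition S_ring :: "nat \<Rightarrow> (var, 'k::comm_ring_1) mpoly set" where
  "S_ring n = polys_in (S_vars n)"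

definition St_ring :: "nat \<Rightarrow> (var, 'k::comm_ring_1) mpoly set" where
  "St_ring n = polys_in (insert T (S_vars n))"

fun var_gt :: "var \<Rightarrow> var \<Rightarrow> bool" where
  "var_gt (X i) (X j) = (i < j)"
| "var_gt (X i) (Y j) = True"
| "var_gt (Y i) (Y j) = (i < j)"
| "var_gt _ _ = False"

definition sigma_less :: "(var \<Rightarrow>\<^sub>0 nat) \<Rightarrow> (var \<Rightarrow>\<^sub>0 nat) \<Rightarrow> bool" where
  "sigma_less = lex_less var_gt"

definition S_part :: "(var \<Rightarrow>\<^sub>0 nat) \<Rightarrow> (var \<Rightarrow>\<^sub>0 nat)" where
  "S_part m = Poly_Mapping.update T 0 m"

definition tau_less :: "(var \<Rightarrow>\<^sub>0 nat) \<Rightarrow> (var \<Rightarrow>\<^sub>0 nat) \<Rightarrow> bool" where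
  "tau_less a b \<longleftrightarrow> Poly_Mapping.lookup a T < Poly_Mapping.lookup b T \<or>
     (Poly_Mapping.lookup a T = Poly_Mapping.lookup b T \<and> sigma_less (S_part a) (S_part b))"

definition graph_on :: "nat \<Rightarrow> (nat \<times> nat) set \<Rightarrow> bool" where
  "graph_on n E \<longleftrightarrow> (\<forall>(i, j) \<in> E. 1 \<le> i \<and> i < j \<and> j \<le> n)"

definition f_edge :: "nat \<times> nat \<Rightarrow> (var, 'k::comm_ring_1) mpoly" where
  "f_edge e = Var (X (fst e)) * Var (Y (snd e)) - Var (X (snd e)) * Var (Y (fst e))"

definition J_G :: "nat \<Rightarrow> (nat \<times> nat) set \<Rightarrow> (var, 'k::comm_ring_1) mpoly set" where
  "J_G n E = ideal_gen (S_ring n) (f_edge ` E)"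

definition closed_graph :: "'k::field itself \<Rightarrow> nat \<Rightarrow> (nat \<times> nat) set \<Rightarrow> bool" where
  "closed_graph _ n E \<longleftrightarrow> is_groebner_basis sigma_less (S_ring n :: (var, 'k::field) mpoly set) (f_edge ` E)"

fun ideal_pow :: "nat \<Rightarrow> (var, 'k::comm_ring_1) mpoly set \<Rightarrow> nat \<Rightarrow> (var, 'k) mpoly set" where
  "ideal_pow n I 0 = S_ring n"
| "ideal_pow n I (Suc k) = ideal_gen (S_ring n) {a * b | a b. a \<in> I \<and> b \<in> ideal_pow n I k}"

definition t_coeff :: "(var, 'k::comm_ring_1) mpoly \<Rightarrow> nat \<Rightarrow> (var, 'k) mpoly" where
  "t_coeff F k = Abs_poly_mapping (\<lambda>m. if Poly_Mapping.lookup m T = 0 then Poly_Mapping.lookup F (Poly_Mapping.update T k m) else 0)"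

definition rees :: "nat \<Rightarrow> (var, 'k::comm_ring_1) mpoly set \<Rightarrow> (var, 'k) mpoly set" where
  "rees n I = {F \<in> St_ring n. \<forall>k. t_coeff F k \<in> ideal_pow n I k}"

datatype rvar = RX nat | RY nat | RT nat nat

definition R_ring :: "nat \<Rightarrow> (nat \<times> nat) set \<Rightarrow> (rvar, 'k::comm_ring_1) mpoly set" where
  "R_ring n E = polys_in (RX ` {1..n} \<union> RY ` {1..n} \<union> (\<lambda>(i, j). RT i j) ` E)"

definition subst :: "('v \<Rightarrow> ('w, 'k::comm_ring_1) mpoly) \<Rightarrow> ('v, 'k) mpoly \<Rightarrow> ('w, 'k) mpoly" where
  "subst g F = (\<Sum>m \<in> Poly_Mapping.keys F. Const (Poly_Mapping.lookup F m) * (\<Prod>v \<in> Poly_Mapping.keys m. g v ^ Poly_Mapping.lookup m v))"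

fun psi_img :: "rvar \<Rightarrow> (var, 'k::comm_ring_1) mpoly" where
  "psi_img (RX i) = Var (X i)"
| "psi_img (RY i) = Var (Y i)"
| "psi_img (RT i j) = f_edge (i, j) * Var T"

definition psi :: "(rvar, 'k::comm_ring_1) mpoly \<Rightarrow> (var, 'k) mpoly" where
  "psi = subst psi_img"

definition ker_psi :: "nat \<Rightarrow> (nat \<times> nat) set \<Rightarrow> (rvar, 'k::comm_ring_1) mpoly set" where
  "ker_psi n E = {F \<in> R_ring n E. psi F = 0}"

text \<open>Bigrading on R making psi homogeneous: deg x_i = deg y_i = (1,0), deg t_e = (2,1).\<close>
definition R_xdeg :: "(rvar \<Rightarrow>\<^sub>0 nat) \<Rightarrow> nat" where
  "R_xdeg m = (\<Sum>v \<in> Poly_Mapping.keys m. (case v of RT _ _ \<Rightarrow> 2 | _ \<Rightarrow> 1) * Poly_Mapping.lookup m v)"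

definition R_tdeg :: "(rvar \<Rightarrow>\<^sub>0 nat) \<Rightarrow> nat" where
  "R_tdeg m = (\<Sum>v \<in> Poly_Mapping.keys m. (case v of RT _ _ \<Rightarrow> 1 | _ \<Rightarrow> 0) * Poly_Mapping.lookup m v)"

definition bihomogeneous :: "(rvar, 'k::comm_ring_1) mpoly \<Rightarrow> bool" where
  "bihomogeneous F \<longleftrightarrow> (\<exists>a b. \<forall>m \<in> Poly_Mapping.keys F. R_xdeg m = a \<and> R_tdeg m = b)"

definition minimal_generators :: "nat \<Rightarrow> (nat \<times> nat) set \<Rightarrow> (rvar, 'k::comm_ring_1) mpoly set \<Rightarrow> bool" where
  "minimal_generators n E Gs \<longleftrightarrow>
     Gs \<subseteq> ker_psi n E \<and> (\<forall>g \<in> Gs. bihomogeneous g) \<and>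
     ideal_gen (R_ring n E) Gs = ker_psi n E \<and>
     (\<forall>g \<in> Gs. ideal_gen (R_ring n E) (Gs - {g}) \<noteq> ker_psi n E)"

definition relation_type_le :: "nat \<Rightarrow> (nat \<times> nat) set \<Rightarrow> 'k::comm_ring_1 itself \<Rightarrow> nat \<Rightarrow> bool" where
  "relation_type_le n E _ r \<longleftrightarrow>
     (\<forall>Gs :: (rvar, 'k) mpoly set. minimal_generators n E Gs \<longrightarrow>
        (\<forall>g \<in> Gs. \<forall>m \<in> Poly_Mapping.keys g. R_tdeg m \<le> r))"

end

(*
  Send the variable t_ij of R to the leading monomial x_i y_j t of f_ij t. Closedness yields exactly
  the edges needed to lift every binomial relation of t-degree at most 2 among these leading
  monomials to a relation of J_G: the correction terms of the Plucker relation and of the S-pairs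
  are again products of edge binomials, of smaller leading monomial. An exchange argument shows that
  any two monomials of R with the same leading monomial are connected by such relations. Hence,
  modulo the ideal L generated by the relations of t-degree at most 2, each element of R is either 0
  or has a representative with a unique monomial of maximal weight. Since the image of the latter
  under psi is nonzero with known leading monomial, L is the whole kernel and the leading monomials
  of the Rees algebra are products of those of the generators.
*)
theory Submission
  imports Defs
begin

text \<open>Closedness enters the lifting argument as two rules: edges \<open>(i, j)\<close>,
  \<open>(i, k)\<close> with \<open>j < k\<close> force \<open>(j, k)\<close>, and edges
  \<open>(i, k)\<close>, \<open>(j, k)\<close> with \<open>i < j\<close> force
  \<open>(i, j)\<close>. The bound 2 is the number of edge variables in each product of the Plucker
  relation; the other lifts, a Koszul relation and two linear syzygies, have \<open>t\<close>-degree
  1. The obstacle is that swapping the endpoints of two edges need not produce edges, so two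
  monomials of equal weight may show no common edge variable. Once one is made common, it is
  cancelled, and induction on the \<open>t\<close>-degree connects the monomials. The descent to a
  representative with a unique top monomial terminates because only finitely many variables occur.
  The two algebras of the claim are compared through a third one, generated by the monomials x_i,
  y_i and x_i y_j t for edges (i, j): closedness identifies it with the Rees algebra of the initial
  ideal. The passage from a kernel generated in \<open>t\<close>-degree at most 2 to a bound on
  every minimal generator uses that minimal generators are bihomogeneous, so they can be sorted by
  \<open>t\<close>-degree.\<close>

abbreviation lookup :: "('a \<Rightarrow>\<^sub>0 'b::zero) \<Rightarrow> 'a \<Rightarrow> 'b" where
  "lookup \<equiv> Poly_Mapping.lookup"

abbreviation keys :: "('a \<Rightarrow>\<^sub>0 'b::zero) \<Rightarrow> 'a set" where
  "keys \<equiv> Poly_Mapping.keys"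

abbreviation mon :: "('v \<Rightarrow>\<^sub>0 nat) \<Rightarrow> ('v, 'k::comm_ring_1) mpoly" where
  "mon m \<equiv> Poly_Mapping.single m 1"

section \<open>Polynomials and substitution\<close>

lemma sum_single_keys:
  fixes F :: "'a \<Rightarrow>\<^sub>0 'b::comm_monoid_add"
  shows "F = (\<Sum>m\<in>keys F. Poly_Mapping.single m (lookup F m))"
proof (rule poly_mapping_eqI)
  fix k
  have "lookup (\<Sum>m\<in>keys F. Poly_Mapping.single m (lookup F m)) k
      = (\<Sum>m\<in>keys F. if m = k then lookup F m else 0)"
    unfolding lookup_sum by (intro sum.cong) (auto simp: lookup_single when_def)
  also have "\<dots> = lookup F k"
    by (simp add: in_keys_iff)
  finally show "lookup F k = lookup (\<Sum>m\<in>keys F. Poly_Mapping.single m (lookup F m)) k" ..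
qed

text \<open>In the \<open>single\<close> case the exponent occurs in the original \<open>F\<close>,
  while the coefficient is arbitrary. Hypotheses on the support of \<open>F\<close> thus stay usable
  without being built into \<open>P\<close>.\<close>

lemma mpoly_induct [case_names zero add single]:
  fixes F :: "'a \<Rightarrow>\<^sub>0 'b::comm_monoid_add"
  assumes "P 0" and "\<And>F G. P F \<Longrightarrow> P G \<Longrightarrow> P (F + G)"
    and "\<And>m c. m \<in> keys F \<Longrightarrow> P (Poly_Mapping.single m c)"
  shows "P F"
proof -
  have "P (\<Sum>m\<in>M. Poly_Mapping.single m (lookup F m))" if "M \<subseteq> keys F" for M
  proof -
    have "finite M" using that finite_keys finite_subset by blast
    then show ?thesis using that
      by (induction M) (auto intro: assms)
  qed
  then show ?thesis using sum_single_keys[of F] by (metis order_refl)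
qed

lemma Const_mult_mono: "Const c * mon m = Poly_Mapping.single m c"
  by (simp add: Const_def mult_single)

lemma Const_simps [simp]: "Const 0 = 0" "Const 1 = 1"
  by (simp_all add: Const_def)

lemma Const_add: "Const (c + d) = Const c + Const d"
  by (simp add: Const_def single_add)

lemma Const_mult: "Const (c * d) = Const c * Const d"
  by (simp add: Const_def mult_single)

lemma keys_plus_nat: "keys (a + b) = keys a \<union> keys (b :: 'v \<Rightarrow>\<^sub>0 nat)"
  by (auto simp: in_keys_iff lookup_add)

lemma mon_add: "mon (a + b) = mon a * mon b"
  by (simp add: mult_single)

lemma single_split: "lookup m v > 0 \<Longrightarrow> \<exists>m'. m = Poly_Mapping.single v (1::nat) + m'"
  by (rule exI[of _ "m - Poly_Mapping.single v 1"], rule poly_mapping_eqI)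
    (auto simp: lookup_add lookup_minus lookup_single when_def)

text \<open>Peels off one variable at a time. Each of them divides the original \<open>m\<close>, so
  hypotheses on the support of \<open>m\<close> remain available at every step.\<close>

lemma monomial_induct [case_names zero add]:
  fixes m :: "'v \<Rightarrow>\<^sub>0 nat"
  assumes "P 0" and "\<And>v m'. v \<in> keys m \<Longrightarrow> P m' \<Longrightarrow> P (Poly_Mapping.single v 1 + m')"
  shows "P m"
proof -
  have "P (\<Sum>v\<in>M. Poly_Mapping.single v (lookup m v))" if "M \<subseteq> keys m" for M
  proof -
    have "finite M" using that finite_keys finite_subset by blast
    then show ?thesis using that
    proof (induction M)
      case (insert v M)
      have "P (Poly_Mapping.single v c + (\<Sum>v\<in>M. Poly_Mapping.single v (lookup m v)))" for c
      proof (induction c)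
        case (Suc c)
        have "P (Poly_Mapping.single v 1 + (Poly_Mapping.single v c + (\<Sum>v\<in>M. Poly_Mapping.single v (lookup m v))))"
          by (rule assms(2)) (use insert Suc in auto)
        moreover have "Poly_Mapping.single v (Suc c) = Poly_Mapping.single v 1 + Poly_Mapping.single v c"
          by (simp flip: single_add)
        ultimately show ?case by (simp only: add.assoc)
      qed (use insert in auto)
      then show ?case using insert by simp
    qed (auto intro: assms)
  qed
  then show ?thesis using sum_single_keys[of m] by (metis order_refl)
qed

lemma mon_single: "mon (Poly_Mapping.single v 1) = Var v"
  by (simp add: Var_def)

lemma polys_in_iff: "f \<in> polys_in V \<longleftrightarrow> (\<forall>m\<in>keys f. keys m \<subseteq> V)"
  by (simp add: polys_in_def)

lemma polys_in_add: "f \<in> polys_in V \<Longrightarrow> g \<in> polys_in V \<Longrightarrow> f + g \<in> polys_in V"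
  using keys_add[of f g] by (fastforce simp: polys_in_iff)

lemma polys_in_mult: "f \<in> polys_in V \<Longrightarrow> g \<in> polys_in V \<Longrightarrow> f * g \<in> polys_in V"
  using keys_mult[of f g] by (fastforce simp: polys_in_iff keys_plus_nat)

lemma polys_in_diff: "f \<in> polys_in V \<Longrightarrow> g \<in> polys_in V \<Longrightarrow> f - g \<in> polys_in V"
  using keys_diff[of f g] by (fastforce simp: polys_in_iff)

lemma polys_in_single: "keys m \<subseteq> V \<Longrightarrow> Poly_Mapping.single m c \<in> polys_in V"
  by (auto simp: polys_in_iff)

lemma polys_in_simps [simp]: "0 \<in> polys_in V" "1 \<in> polys_in V" "Const c \<in> polys_in V"
  by (auto simp: polys_in_iff Const_def)

lemma polys_in_Var: "v \<in> V \<Longrightarrow> Var v \<in> polys_in V"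
  by (auto simp: polys_in_iff Var_def)

lemma polys_in_mono: "V \<subseteq> W \<Longrightarrow> polys_in V \<subseteq> polys_in W"
  unfolding polys_in_def by blast

section \<open>Substitution as a ring homomorphism\<close>

definition monsub :: "('v \<Rightarrow> ('w, 'k::comm_ring_1) mpoly) \<Rightarrow> ('v \<Rightarrow>\<^sub>0 nat) \<Rightarrow> ('w, 'k) mpoly" where
  "monsub g m = (\<Prod>v \<in> keys m. g v ^ lookup m v)"

lemma monsub_superset: "finite A \<Longrightarrow> keys m \<subseteq> A \<Longrightarrow> monsub g m = (\<Prod>v \<in> A. g v ^ lookup m v)"
  unfolding monsub_def by (rule prod.mono_neutral_left) (auto simp: in_keys_iff)

lemma monsub_add: "monsub g (a + b) = monsub g a * monsub g b"
proof -
  let ?A = "keys a \<union> keys b"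
  have "monsub g (a + b) = (\<Prod>v \<in> ?A. g v ^ lookup (a + b) v)"
    by (simp add: monsub_def keys_plus_nat)
  also have "\<dots> = (\<Prod>v \<in> ?A. g v ^ lookup a v) * (\<Prod>v \<in> ?A. g v ^ lookup b v)"
    by (simp add: lookup_add power_add prod.distrib)
  also have "\<dots> = monsub g a * monsub g b"
    using monsub_superset[of ?A a g] monsub_superset[of ?A b g] by simp
  finally show ?thesis .
qed

lemma monsub_simps [simp]: "monsub g 0 = 1" "monsub g (Poly_Mapping.single v (Suc 0)) = g v"
  by (auto simp: monsub_def)

lemma subst_eq: "subst g F = (\<Sum>m \<in> keys F. Const (lookup F m) * monsub g m)"
  by (simp add: subst_def monsub_def)

lemma subst_add: "subst g (F + G) = subst g F + subst g G"
  unfolding subst_eq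
  by (rule setsum_keys_plus_distrib) (auto simp: Const_add algebra_simps)

lemma subst_single: "subst g (Poly_Mapping.single m c) = Const c * monsub g m"
  by (auto simp: subst_eq)

lemma subst_0 [simp]: "subst g 0 = 0"
  by (simp add: subst_eq)

lemma subst_Const: "subst g (Const c) = Const c"
  by (simp add: Const_def subst_single mult_single)

lemma subst_Var: "subst g (Var v) = g v"
  by (simp add: Var_def subst_single)

lemma subst_uminus: "subst g (- F) = - subst g F"
  using subst_add[of g "-F" F] by (simp add: eq_neg_iff_add_eq_0)

lemma subst_diff: "subst g (F - G) = subst g F - subst g G"
  using subst_add[of g F "- G"] by (simp add: subst_uminus)

lemma subst_single_mult:
  "subst g (Poly_Mapping.single m c * G) = subst g (Poly_Mapping.single m c) * subst g G"
proof (induction G rule: mpoly_induct)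
  case (single m' c')
  then show ?case
    by (simp add: mult_single subst_single monsub_add Const_mult mult_ac)
qed (auto simp: subst_add algebra_simps)

lemma subst_mult: "subst g (F * G) = subst g F * subst g G"
proof (induction F rule: mpoly_induct)
  case (single m c)
  then show ?case by (simp add: subst_single_mult)
qed (auto simp: subst_add algebra_simps)

section \<open>Generated ideals and algebras\<close>

lemma ideal_gen_mono: "B \<subseteq> C \<Longrightarrow> ideal_gen R B \<subseteq> ideal_gen R C"
proof
  fix x assume "B \<subseteq> C" "x \<in> ideal_gen R B"
  from this(2,1) show "x \<in> ideal_gen R C"
    by (induction rule: ideal_gen.induct) (auto intro: ideal_gen.intros)
qed

lemma ideal_gen_subset:
  assumes "B \<subseteq> ideal_gen R C" shows "ideal_gen R B \<subseteq> ideal_gen R C"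
proof
  fix x assume "x \<in> ideal_gen R B"
  then show "x \<in> ideal_gen R C"
    by (induction rule: ideal_gen.induct) (use assms in \<open>auto intro: ideal_gen.intros\<close>)
qed

lemma ideal_gen_subset_ring:
  fixes B :: "('v, 'k::comm_ring_1) mpoly set"
  assumes "B \<subseteq> polys_in V" shows "ideal_gen (polys_in V) B \<subseteq> polys_in V"
proof
  fix x assume "x \<in> ideal_gen (polys_in V) B"
  then show "x \<in> polys_in V"
    by (induction rule: ideal_gen.induct) (use assms in \<open>auto intro: polys_in_add polys_in_mult\<close>)
qed

lemma ideal_gen_uminus:
  fixes B :: "('v, 'k::comm_ring_1) mpoly set"
  assumes a: "a \<in> ideal_gen (polys_in V) B" shows "- a \<in> ideal_gen (polys_in V) B"
proof -
  have "Const (-1) * a \<in> ideal_gen (polys_in V) B"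
    by (intro ideal_gen.mult assms) simp
  moreover have "Const (-1) * a = - a"
    by (simp add: Const_def single_uminus)
  ultimately show ?thesis by simp
qed

lemma ideal_gen_diff:
  fixes B :: "('v, 'k::comm_ring_1) mpoly set"
  shows
  "a \<in> ideal_gen (polys_in V) B \<Longrightarrow> c \<in> ideal_gen (polys_in V) B \<Longrightarrow> a - c \<in> ideal_gen (polys_in V) B"
  by (subst diff_conv_add_uminus) (intro ideal_gen.add ideal_gen_uminus)

lemma alg_gen_mono: "B \<subseteq> alg_gen C \<Longrightarrow> alg_gen B \<subseteq> alg_gen C"
proof
  fix x assume "B \<subseteq> alg_gen C" "x \<in> alg_gen B"
  from this(2,1) show "x \<in> alg_gen C"
    by (induction rule: alg_gen.induct) (auto intro: alg_gen.intros)
qed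

lemma alg_gen_0: "0 \<in> alg_gen B"
  using alg_gen.const[of 0 B] by simp

lemma alg_gen_1: "1 \<in> alg_gen B"
  using alg_gen.const[of 1 B] by simp

lemma alg_gen_sum: "(\<And>i. i \<in> I \<Longrightarrow> f i \<in> alg_gen B) \<Longrightarrow> sum f I \<in> alg_gen B"
  by (induction I rule: infinite_finite_induct) (auto intro: alg_gen_0 alg_gen.add)

lemma polys_in_subset_alg_gen:
  fixes B :: "('v, 'k::comm_ring_1) mpoly set"
  assumes "Var ` V \<subseteq> alg_gen B" shows "polys_in V \<subseteq> alg_gen B"
proof
  fix f :: "('v, 'k) mpoly" assume f: "f \<in> polys_in V"
  show "f \<in> alg_gen B"
  proof (induction f rule: mpoly_induct)
    case (single m c)
    then have m: "keys m \<subseteq> V" using f by (auto simp: polys_in_iff)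
    have "mon m \<in> alg_gen B"
    proof (induction m rule: monomial_induct)
      case (add v m')
      then have "Var v * mon m' \<in> alg_gen B"
        using m assms by (intro alg_gen.mult) auto
      then show ?case by (simp only: mon_add mon_single)
    qed (auto intro: alg_gen_1)
    then show ?case
      using alg_gen.mult[OF alg_gen.const] Const_mult_mono by metis
  qed (auto intro: alg_gen_0 alg_gen.add)
qed

section \<open>The term order\<close>

text \<open>\<open>vgt\<close> puts \<open>T\<close> on top, so that \<open>tau_less\<close> becomes a plain lexicographic order.\<close>

fun vgt :: "var \<Rightarrow> var \<Rightarrow> bool" where
  "vgt T T = False"
| "vgt T _ = True"
| "vgt a b = var_gt a b"

lemma vgt_trans: "vgt a b \<Longrightarrow> vgt b c \<Longrightarrow> vgt a c"
  by (cases a; cases b; cases c) auto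

lemma vgt_total: "a \<noteq> b \<Longrightarrow> vgt a b \<or> vgt b a"
  by (cases a; cases b) auto

lemma vgt_irrefl: "\<not> vgt a a"
  by (cases a) auto

lemma tau_less_eq: "tau_less = lex_less vgt"
proof (intro ext)
  fix a b :: "var \<Rightarrow>\<^sub>0 nat"
  have S: "lookup (S_part m) v = (if v = T then 0 else lookup m v)" for m v
    by (auto simp: S_part_def lookup_update)
  show "tau_less a b = lex_less vgt a b"
  proof
    assume "tau_less a b"
    then consider "lookup a T < lookup b T"
      | v where "lookup a T = lookup b T" "v \<noteq> T" "lookup a v < lookup b v"
          "\<And>w. var_gt w v \<Longrightarrow> w \<noteq> T \<Longrightarrow> lookup a w = lookup b w"
      unfolding tau_less_def sigma_less_def lex_less_def S by (force split: if_splits)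
    then show "lex_less vgt a b"
    proof cases
      case 1
      moreover have "\<not> vgt w T" for w by (cases w) auto
      ultimately show ?thesis unfolding lex_less_def by blast
    next
      case 2
      have "lookup a w = lookup b w" if "vgt w v" for w
        using that 2 by (cases w; cases v) auto
      then show ?thesis unfolding lex_less_def using 2 by blast
    qed
  next
    assume "lex_less vgt a b"
    then obtain v where v: "lookup a v < lookup b v" "\<And>w. vgt w v \<Longrightarrow> lookup a w = lookup b w"
      unfolding lex_less_def by blast
    show "tau_less a b"
    proof (cases "v = T")
      case False
      then have "vgt T v" by (cases v) auto
      then have "lookup a T = lookup b T" using v by blast
      moreover have "vgt w v" if "var_gt w v" "w \<noteq> T" for w
        using that by (cases w; cases v) auto
      ultimately show ?thesis using v False
        unfolding tau_less_def sigma_less_def lex_less_def S by (auto intro!: exI[of _ v])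
    qed (use v in \<open>auto simp: tau_less_def\<close>)
  qed
qed

lemma tau_irrefl: "\<not> tau_less a a"
  by (auto simp: tau_less_eq lex_less_def)

lemma tau_trans:
  assumes "tau_less a b" "tau_less b c" shows "tau_less a c"
proof -
  obtain v where v: "lookup a v < lookup b v" "\<And>w. vgt w v \<Longrightarrow> lookup a w = lookup b w"
    using assms unfolding tau_less_eq lex_less_def by blast
  obtain u where u: "lookup b u < lookup c u" "\<And>w. vgt w u \<Longrightarrow> lookup b w = lookup c w"
    using assms unfolding tau_less_eq lex_less_def by blast
  consider "u = v" | "vgt u v" | "vgt v u" using vgt_total by blast
  then show ?thesis
  proof cases
    case 1
    then show ?thesis using v u unfolding tau_less_eq lex_less_def by (intro exI[of _ v]) auto
  next
    case 2
    then have "lookup a u < lookup c u" "\<And>w. vgt w u \<Longrightarrow> lookup a w = lookup c w"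
      using v(2)[of u] u(1) v(2)[OF vgt_trans[of _ u v]] u(2) by auto
    then show ?thesis unfolding tau_less_eq lex_less_def by blast
  next
    case 3
    then have "lookup a v < lookup c v" "\<And>w. vgt w v \<Longrightarrow> lookup a w = lookup c w"
      using u(2)[of v] v(1) u(2)[OF vgt_trans[of _ v u]] v(2) by auto
    then show ?thesis unfolding tau_less_eq lex_less_def by blast
  qed
qed

lemma finite_vgt_max:
  assumes "finite A" "A \<noteq> {}"
  shows "\<exists>v\<in>A. \<forall>w\<in>A. \<not> vgt w v"
  using assms
proof (induction rule: finite_ne_induct)
  case (insert x A)
  then obtain v where v: "v \<in> A" "\<And>w. w \<in> A \<Longrightarrow> \<not> vgt w v" by blast
  show ?case
  proof (cases "vgt x v")
    case True
    then show ?thesis using v vgt_trans[of _ x v] vgt_irrefl by blast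
  next
    case False
    then show ?thesis using v by blast
  qed
qed (auto simp: vgt_irrefl)

lemma tau_total:
  assumes "a \<noteq> b" shows "tau_less a b \<or> tau_less b a"
proof -
  \<comment> \<open>The exponents have finite support, so there is a highest variable where they
    differ; it decides the comparison.\<close>
  define D where "D = {v. lookup a v \<noteq> lookup b v}"
  have "D \<subseteq> keys a \<union> keys b" by (auto simp: D_def in_keys_iff)
  then have "finite D" by (rule finite_subset) simp
  moreover have "D \<noteq> {}"
    unfolding D_def using assms poly_mapping_eqI[of a b] by blast
  ultimately obtain v where v: "v \<in> D" "\<forall>w\<in>D. \<not> vgt w v"
    using finite_vgt_max[of D] by auto
  then have "\<forall>w. vgt w v \<longrightarrow> lookup a w = lookup b w"
    unfolding D_def by blast
  moreover from v have "lookup a v < lookup b v \<or> lookup b v < lookup a v"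
    by (auto simp: D_def)
  ultimately show ?thesis
    unfolding tau_less_eq lex_less_def by (metis (full_types))
qed

lemma tau_add: "tau_less (c + a) (c + b) \<longleftrightarrow> tau_less a b"
  unfolding tau_less_eq lex_less_def by (simp add: lookup_add)

lemma tau_add_mono: "tau_less a b \<Longrightarrow> tau_less c d \<Longrightarrow> tau_less (a + c) (b + d)"
  using tau_trans[of "a + c" "a + d" "b + d"] tau_add[of a c d] tau_add[of d a b]
  by (simp add: add.commute)

definition Tvars :: "nat \<Rightarrow> var set" where
  "Tvars n = insert T (S_vars n)"

text \<open>On the whole type the variables x_1 > x_2 > ... descend forever, hence the restriction
  to the variables of S[t]. Listing these in decreasing order turns \<open>tau_less\<close> into the
  lexicographic order on exponent lists of one fixed length, which is well-founded.\<close>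

lemma tau_wf: "wf {(a, b). tau_less a b \<and> keys a \<subseteq> Tvars n \<and> keys b \<subseteq> Tvars n}"
proof -
  define vs where "vs = T # map X [1..<Suc n] @ map Y [1..<Suc n]"
  have set_vs: "set vs = Tvars n"
    by (simp add: vs_def Tvars_def S_vars_def atLeastLessThanSuc_atLeastAtMost del: upt_Suc)
  have sorted: "sorted_wrt vgt vs"
    unfolding vs_def by (auto simp del: upt_Suc simp: sorted_wrt_append sorted_wrt_map sorted_wrt_upt)
  have "(map (lookup a) vs, map (lookup b) vs) \<in> lex less_than"
    if ab: "tau_less a b" "keys a \<subseteq> Tvars n" "keys b \<subseteq> Tvars n" for a b
  proof -
    obtain v where v: "lookup a v < lookup b v" "\<And>w. vgt w v \<Longrightarrow> lookup a w = lookup b w"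
      using ab(1) unfolding tau_less_eq lex_less_def by blast
    then have "v \<in> set vs" using ab(3) set_vs by (auto simp: in_keys_iff)
    then obtain p q where pq: "vs = p @ v # q" by (meson split_list)
    have "map (lookup a) p = map (lookup b) p"
      using sorted v(2) unfolding pq by (auto simp: sorted_wrt_append)
    then have "(map (lookup a) p @ lookup a v # map (lookup a) q,
        map (lookup a) p @ lookup b v # map (lookup b) q) \<in> lex less_than"
      using v(1) by (intro lex_append_leftI) simp
    then show ?thesis
      unfolding pq map_append list.map \<open>map (lookup a) p = map (lookup b) p\<close> .
  qed
  then have "{(a, b). tau_less a b \<and> keys a \<subseteq> Tvars n \<and> keys b \<subseteq> Tvars n}
      \<subseteq> inv_image (lex less_than) (\<lambda>a. map (lookup a) vs)"
    by (auto simp: inv_image_def)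
  moreover have "wf (inv_image (lex less_than) (\<lambda>a. map (lookup a) vs))"
    by (intro wf_inv_image wf_lex wf_less_than)
  ultimately show ?thesis by (rule wf_subset[rotated])
qed

lemma tau_max:
  assumes "finite A" "A \<noteq> {}"
  shows "\<exists>m\<in>A. \<forall>m'\<in>A. m' \<noteq> m \<longrightarrow> tau_less m' m"
  using assms
proof (induction rule: finite_ne_induct)
  case (insert x A)
  then obtain m where m: "m \<in> A" "\<And>m'. m' \<in> A \<Longrightarrow> m' \<noteq> m \<Longrightarrow> tau_less m' m" by blast
  show ?case
  proof (cases "tau_less m x")
    case True
    then have "tau_less m' x" if "m' \<in> A" for m'
      using that m(2)[of m'] tau_trans[of m' m x] by (cases "m' = m") auto
    then show ?thesis by blast
  next
    case False
    with insert.hyps m(1) have "tau_less x m" using tau_total[of x m] by blast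
    then show ?thesis using m by blast
  qed
qed auto

section \<open>Leading monomials\<close>

definition is_lm :: "(var, 'k::comm_ring_1) mpoly \<Rightarrow> (var \<Rightarrow>\<^sub>0 nat) \<Rightarrow> bool" where
  "is_lm f m \<longleftrightarrow> m \<in> keys f \<and> (\<forall>m'\<in>keys f. m' \<noteq> m \<longrightarrow> tau_less m' m)"

lemma is_lm_unique: "is_lm f m \<Longrightarrow> is_lm f m' \<Longrightarrow> m = m'"
  unfolding is_lm_def by (metis tau_irrefl tau_trans)

lemma lead_mon_tau: "is_lm f m \<Longrightarrow> lead_mon tau_less f = m"
  unfolding lead_mon_def
  by (rule the_equality) (auto simp: is_lm_def intro: is_lm_unique[of f, unfolded is_lm_def])

lemma init_tau: "is_lm f m \<Longrightarrow> init tau_less f = Poly_Mapping.single m (lookup f m)"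
  by (simp add: init_def lead_mon_tau)

text \<open>With leading coefficient 1, leading monomials are multiplicative over any commutative
  ring. Images of monomials of R under \<open>psi\<close> are of this kind.\<close>

definition monic_lm :: "(var, 'k::comm_ring_1) mpoly \<Rightarrow> (var \<Rightarrow>\<^sub>0 nat) \<Rightarrow> bool" where
  "monic_lm f m \<longleftrightarrow> lookup f m = 1 \<and> (\<forall>m'\<in>keys f. m' \<noteq> m \<longrightarrow> tau_less m' m)"

lemma monic_lm_is_lm: "monic_lm f m \<Longrightarrow> is_lm f m"
  by (auto simp: monic_lm_def is_lm_def in_keys_iff)

lemma monic_lm_tail:
  "monic_lm f m \<longleftrightarrow> (\<exists>h. f = mon m + h \<and> (\<forall>m'\<in>keys h. tau_less m' m))"
proof
  assume f: "monic_lm f m"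
  have "tau_less m' m" if "m' \<in> keys (f - mon m)" for m'
  proof -
    from that f have "m' \<noteq> m" by (auto simp: in_keys_iff lookup_minus monic_lm_def)
    with that have "m' \<in> keys f" by (auto simp: in_keys_iff lookup_minus lookup_single)
    with f \<open>m' \<noteq> m\<close> show ?thesis by (auto simp: monic_lm_def)
  qed
  then show "\<exists>h. f = mon m + h \<and> (\<forall>m'\<in>keys h. tau_less m' m)"
    by (intro exI[of _ "f - mon m"]) auto
next
  assume "\<exists>h. f = mon m + h \<and> (\<forall>m'\<in>keys h. tau_less m' m)"
  then obtain h where h: "f = mon m + h" "\<And>m'. m'\<in>keys h \<Longrightarrow> tau_less m' m" by blast
  have "lookup h m = 0" using h(2)[of m] by (auto simp: in_keys_iff tau_irrefl)
  then show "monic_lm f m"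
    unfolding monic_lm_def h(1) using h(2) keys_add[of "mon m" h]
    by (fastforce simp: lookup_add)
qed

lemma monic_lm_mult:
  assumes "monic_lm f m" "monic_lm g k" shows "monic_lm (f * g) (m + k)"
proof -
  obtain h where h: "f = mon m + h" "\<And>m'. m'\<in>keys h \<Longrightarrow> tau_less m' m"
    using assms(1) by (auto simp: monic_lm_tail)
  obtain l where l: "g = mon k + l" "\<And>m'. m'\<in>keys l \<Longrightarrow> tau_less m' k"
    using assms(2) by (auto simp: monic_lm_tail)
  have "f * g = mon (m + k) + (mon m * l + (h * mon k + h * l))"
    by (simp add: h(1) l(1) algebra_simps mult_single)
  moreover have "tau_less m' (m + k)" if "m' \<in> keys (mon m * l + (h * mon k + h * l))" for m'
  proof -
    have "m' \<in> keys (mon m * l) \<or> m' \<in> keys (h * mon k) \<or> m' \<in> keys (h * l)"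
      using that keys_add[of "mon m * l" "h * mon k + h * l"] keys_add[of "h * mon k" "h * l"] by blast
    then show ?thesis
    proof (elim disjE)
      assume "m' \<in> keys (mon m * l)"
      then obtain a where "a \<in> keys l" "m' = m + a"
        using keys_mult[of "mon m" l] by auto
      then show ?thesis using l(2) by (simp add: tau_add)
    next
      assume "m' \<in> keys (h * mon k)"
      then obtain a where "a \<in> keys h" "m' = k + a"
        using keys_mult[of h "mon k"] by (auto simp: add.commute)
      then show ?thesis using h(2) tau_add[of k a m] by (simp add: add.commute)
    next
      assume "m' \<in> keys (h * l)"
      then obtain a b where "a \<in> keys h" "b \<in> keys l" "m' = a + b"
        using keys_mult[of h l] by auto
      then show ?thesis using h(2) l(2) tau_add_mono by blast
    qed
  qed
  ultimately show ?thesis unfolding monic_lm_tail by blast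
qed

lemma monic_lm_mon: "monic_lm (mon m) m"
  by (auto simp: monic_lm_def)

text \<open>On monomials free of \<open>T\<close> the two orders coincide. This lets closedness,
  stated for \<open>sigma_less\<close>, be used with the leading monomials computed for
  \<open>tau_less\<close>.\<close>

lemma lead_mon_sigma:
  assumes "f \<in> polys_in V" "T \<notin> V"
  shows "lead_mon sigma_less f = lead_mon tau_less f"
proof -
  have "sigma_less a b = tau_less a b" if "a \<in> keys f" "b \<in> keys f" for a b
  proof -
    have "lookup a T = 0" "lookup b T = 0"
      using that assms unfolding polys_in_iff by (metis in_keys_iff subsetD)+
    moreover from this have "S_part a = a" "S_part b = b"
      by (auto simp: S_part_def lookup_update intro!: poly_mapping_eqI)
    ultimately show ?thesis by (simp add: tau_less_def)
  qed
  then have "(m \<in> keys f \<and> (\<forall>m'\<in>keys f. m' \<noteq> m \<longrightarrow> sigma_less m' m)) \<longleftrightarrow>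
      (m \<in> keys f \<and> (\<forall>m'\<in>keys f. m' \<noteq> m \<longrightarrow> tau_less m' m))" for m
    by blast
  then show ?thesis unfolding lead_mon_def by presburger
qed

lemma init_sigma:
  "f \<in> polys_in V \<Longrightarrow> T \<notin> V \<Longrightarrow> init sigma_less f = init tau_less f"
  by (simp add: init_def lead_mon_sigma)

section \<open>Rees algebras\<close>

abbreviation tpow :: "nat \<Rightarrow> (var, 'k::comm_ring_1) mpoly" where
  "tpow k \<equiv> mon (Poly_Mapping.single T k)"

lemma tpow_simps: "tpow 0 = 1" "tpow (Suc 0) = Var T" "tpow (j + k) = tpow j * tpow k"
  by (auto simp: Var_def mult_single simp flip: single_add)

lemma T_notin_S_vars [simp]: "T \<notin> S_vars n"
  by (auto simp: S_vars_def)

text \<open>Removing the power of \<open>T\<close> and restoring it are mutually inverse;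
  computations with \<open>t_coeff\<close> rest on this.\<close>

lemma update_T_eq_iff:
  "Poly_Mapping.update T k m = p \<and> lookup m T = 0 \<longleftrightarrow> lookup p T = (k::nat) \<and> m = Poly_Mapping.update T 0 p"
  by (auto simp: poly_mapping_eq_iff fun_eq_iff lookup_update)

text \<open>\<open>Abs_poly_mapping\<close> can be unfolded only for finite support; here the
  support lies in the \<open>T\<close>-free parts of \<open>keys F\<close>.\<close>

lemma lookup_t_coeff:
  fixes F :: "(var, 'k::comm_ring_1) mpoly"
  shows "lookup (t_coeff F k) m = (if lookup m T = 0 then lookup F (Poly_Mapping.update T k m) else 0)"
proof -
  have "{m. (if lookup m T = 0 then lookup F (Poly_Mapping.update T k m) else 0) \<noteq> 0}
      \<subseteq> Poly_Mapping.update T 0 ` keys F"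
  proof
    fix m assume "m \<in> {m. (if lookup m T = 0 then lookup F (Poly_Mapping.update T k m) else 0) \<noteq> 0}"
    then have "lookup m T = 0" "Poly_Mapping.update T k m \<in> keys F"
      by (auto simp: in_keys_iff split: if_splits)
    then show "m \<in> Poly_Mapping.update T 0 ` keys F"
      using update_T_eq_iff[of k m] by blast
  qed
  then have "finite {m. (if lookup m T = 0 then lookup F (Poly_Mapping.update T k m) else 0) \<noteq> 0}"
    by (rule finite_subset) simp
  then show ?thesis unfolding t_coeff_def by simp
qed

lemma t_coeff_add: "t_coeff (F + G) k = t_coeff F k + t_coeff G k"
  by (rule poly_mapping_eqI) (simp add: lookup_t_coeff lookup_add)

lemma t_coeff_0 [simp]: "t_coeff 0 k = 0"
  by (rule poly_mapping_eqI) (simp add: lookup_t_coeff)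

lemma t_coeff_single:
  "t_coeff (Poly_Mapping.single p c) k
    = (if lookup p T = k then Poly_Mapping.single (Poly_Mapping.update T 0 p) c else 0)"
proof (rule poly_mapping_eqI)
  fix m
  show "lookup (t_coeff (Poly_Mapping.single p c) k) m = lookup (if lookup p T = k then Poly_Mapping.single (Poly_Mapping.update T 0 p) c else 0) m"
    using update_T_eq_iff[of k m p]
    by (auto simp: lookup_t_coeff lookup_single when_def lookup_update)
qed

lemma update_T_plus: "Poly_Mapping.update T 0 p + Poly_Mapping.single T (lookup p T) = (p :: var \<Rightarrow>\<^sub>0 nat)"
  by (rule poly_mapping_eqI) (simp add: lookup_update lookup_add lookup_single when_def)

lemma t_coeff_decomp:
  fixes F :: "(var, 'k::comm_ring_1) mpoly"
  assumes "\<And>m. m \<in> keys F \<Longrightarrow> lookup m T < N"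
  shows "F = (\<Sum>k<N. t_coeff F k * tpow k)"
proof (induction F rule: mpoly_induct)
  case (add F G)
  then show ?case by (simp add: t_coeff_add ring_distribs sum.distrib)
next
  case (single m c)
  have "(\<Sum>k<N. t_coeff (Poly_Mapping.single m c) k * tpow k)
      = (\<Sum>k<N. if lookup m T = k then Poly_Mapping.single m c else 0)"
    by (intro sum.cong) (auto simp: t_coeff_single mult_single update_T_plus)
  also have "\<dots> = Poly_Mapping.single m c"
    using assms[OF single] by simp
  finally show ?case ..
qed simp

lemma t_coeff_mult_tpow:
  fixes f :: "(var, 'k::comm_ring_1) mpoly"
  assumes "f \<in> S_ring n"
  shows "t_coeff (f * tpow k) j = (if j = k then f else 0)"
proof (induction f rule: mpoly_induct)
  case (add F G)
  then show ?case by (simp add: t_coeff_add ring_distribs)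
next
  case (single m c)
  then have "lookup m T = 0"
    using assms T_notin_S_vars[of n] unfolding S_ring_def polys_in_iff by (meson in_keys_iff subsetD)
  moreover from this have "Poly_Mapping.update T 0 (m + Poly_Mapping.single T k) = m"
    by (intro poly_mapping_eqI) (auto simp: lookup_update lookup_add lookup_single when_def)
  ultimately show ?case by (auto simp: mult_single t_coeff_single lookup_add)
qed simp

lemma S_ring_subset_St_ring: "S_ring n \<subseteq> St_ring n"
  unfolding S_ring_def St_ring_def by (rule polys_in_mono) auto

text \<open>Kept abstract in the generators since it is instantiated twice: for \<open>J_G\<close>
  with the edge binomials, and for its initial ideal with their initial terms.\<close>

locale S_ideal =
  fixes n :: nat and G I :: "(var, 'k::comm_ring_1) mpoly set"
  assumes G: "G \<subseteq> S_ring n" and I_def: "I = ideal_gen (S_ring n) G"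
begin

lemma I_subset: "I \<subseteq> S_ring n"
  using G ideal_gen_subset_ring unfolding I_def S_ring_def by blast

lemma ideal_pow_subset: "ideal_pow n I k \<subseteq> S_ring n"
proof (induction k)
  case (Suc k)
  then have "{a * b |a b. a \<in> I \<and> b \<in> ideal_pow n I k} \<subseteq> S_ring n"
    using I_subset polys_in_mult unfolding S_ring_def by blast
  then show ?case
    unfolding S_ring_def ideal_pow.simps(2) by (rule ideal_gen_subset_ring)
qed simp

lemma ideal_pow_0: "0 \<in> ideal_pow n I k"
  by (cases k) (auto simp: S_ring_def intro: ideal_gen.zero)

lemma ideal_pow_add: "a \<in> ideal_pow n I k \<Longrightarrow> b \<in> ideal_pow n I k \<Longrightarrow> a + b \<in> ideal_pow n I k"
  by (cases k) (auto simp: S_ring_def intro: polys_in_add ideal_gen.add)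

lemma ideal_pow_smult: "r \<in> S_ring n \<Longrightarrow> a \<in> ideal_pow n I k \<Longrightarrow> r * a \<in> ideal_pow n I k"
  by (cases k) (auto simp: S_ring_def intro: polys_in_mult ideal_gen.mult)

lemma ideal_pow_mult:
  assumes b: "b \<in> ideal_pow n I l"
  shows "a \<in> ideal_pow n I k \<Longrightarrow> a * b \<in> ideal_pow n I (k + l)"
proof (induction k arbitrary: a)
  case 0
  then show ?case using b ideal_pow_smult by simp
next
  case (Suc k)
  then have "a \<in> ideal_gen (S_ring n) {a * b |a b. a \<in> I \<and> b \<in> ideal_pow n I k}" by simp
  then have "a * b \<in> ideal_pow n I (Suc k + l)"
  proof (induction rule: ideal_gen.induct)
    case zero
    then show ?case using ideal_pow_0[of "Suc k + l"] by simp
  next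
    case (gen c)
    then obtain p q where "c = p * q" "p \<in> I" "q \<in> ideal_pow n I k" by blast
    moreover from this have "q * b \<in> ideal_pow n I (k + l)" using Suc.IH by blast
    ultimately have "c * b \<in> {a * b |a b. a \<in> I \<and> b \<in> ideal_pow n I (k + l)}"
      by (auto simp: mult.assoc)
    then show ?case by (auto intro: ideal_gen.gen)
  next
    case (add a c)
    then show ?case using ideal_pow_add by (simp only: ring_distribs)
  next
    case (mult r a)
    then show ?case using ideal_pow_smult by (simp only: mult.assoc)
  qed
  then show ?case .
qed

lemma ideal_pow_mult_tpow_in_rees:
  assumes "a \<in> ideal_pow n I k" shows "a * tpow k \<in> rees n I"
proof -
  have a: "a \<in> S_ring n" using assms ideal_pow_subset by blast
  have "tpow k \<in> St_ring n" unfolding St_ring_def by (rule polys_in_single) auto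
  then have "a * tpow k \<in> St_ring n"
    using a S_ring_subset_St_ring polys_in_mult unfolding St_ring_def by blast
  then show ?thesis
    unfolding rees_def using assms ideal_pow_0 by (auto simp: t_coeff_mult_tpow[OF a])
qed

lemma rees_0: "0 \<in> rees n I"
  by (auto simp: rees_def St_ring_def ideal_pow_0)

lemma rees_add: "F \<in> rees n I \<Longrightarrow> H \<in> rees n I \<Longrightarrow> F + H \<in> rees n I"
  by (auto simp: rees_def t_coeff_add St_ring_def intro: ideal_pow_add polys_in_add)

lemma rees_sum: "(\<And>i. i \<in> A \<Longrightarrow> f i \<in> rees n I) \<Longrightarrow> sum f A \<in> rees n I"
  by (induction A rule: infinite_finite_induct) (auto intro: rees_0 rees_add)

lemma rees_decomp: "\<exists>N. F = (\<Sum>k<N. t_coeff F k * tpow k)"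
proof -
  have "lookup m T < Suc (Max ((\<lambda>m. lookup m T) ` keys F))" if "m \<in> keys F" for m
    using that by (simp add: less_Suc_eq_le)
  then show ?thesis using t_coeff_decomp by blast
qed

lemma rees_mult:
  assumes "F \<in> rees n I" "H \<in> rees n I" shows "F * H \<in> rees n I"
proof -
  obtain N where N: "F = (\<Sum>k<N. t_coeff F k * tpow k)"
    using rees_decomp by blast
  obtain M where M: "H = (\<Sum>k<M. t_coeff H k * tpow k)"
    using rees_decomp by blast
  have "F * H = (\<Sum>k<N. \<Sum>l<M. (t_coeff F k * tpow k) * (t_coeff H l * tpow l))"
    using sum_product[of "\<lambda>k. t_coeff F k * tpow k" "{..<N}" "\<lambda>l. t_coeff H l * tpow l" "{..<M}"] N M
    by simp
  also have "\<dots> = (\<Sum>k<N. \<Sum>l<M. (t_coeff F k * t_coeff H l) * tpow (k + l))"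
    by (simp only: tpow_simps(3) mult_ac)
  also have "\<dots> \<in> rees n I"
    using assms by (intro rees_sum ideal_pow_mult_tpow_in_rees ideal_pow_mult) (auto simp: rees_def)
  finally show ?thesis .
qed

lemma S_ring_subset_rees: "S_ring n \<subseteq> rees n I"
  using ideal_pow_mult_tpow_in_rees[of _ 0] by auto

lemma gen_mult_T_in_rees:
  assumes "g \<in> G" shows "g * Var T \<in> rees n I"
proof -
  have "g \<in> I" using assms by (auto simp: I_def intro: ideal_gen.gen)
  moreover have "1 \<in> S_ring n" by (simp add: S_ring_def)
  ultimately have "g * 1 \<in> {a * b |a b. a \<in> I \<and> b \<in> ideal_pow n I 0}" by fastforce
  then have "g * 1 \<in> ideal_pow n I (Suc 0)"
    unfolding ideal_pow.simps(2) by (rule ideal_gen.gen)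
  then show ?thesis using ideal_pow_mult_tpow_in_rees[of g "Suc 0"] by (simp add: tpow_simps)
qed

lemma alg_gen_subset_rees:
  assumes "B \<subseteq> rees n I" shows "alg_gen B \<subseteq> rees n I"
proof
  fix F assume "F \<in> alg_gen B"
  then show "F \<in> rees n I"
  proof (induction rule: alg_gen.induct)
    case (const c)
    then show ?case using S_ring_subset_rees by (auto simp: S_ring_def)
  qed (use assms in \<open>auto intro: rees_add rees_mult\<close>)
qed

text \<open>The piece I^k t^k is spanned over S by products of k factors g t, so it suffices to have
  the variables and the elements g t.\<close>

lemma rees_subset_alg_gen:
  assumes V: "Var ` S_vars n \<subseteq> alg_gen B" and g: "\<And>g. g \<in> G \<Longrightarrow> g * Var T \<in> alg_gen B"
  shows "rees n I \<subseteq> alg_gen B"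
proof
  have S: "S_ring n \<subseteq> alg_gen B"
    using polys_in_subset_alg_gen[OF V] by (simp add: S_ring_def)
  have I: "a * Var T \<in> alg_gen B" if "a \<in> I" for a
    using that unfolding I_def
  proof (induction rule: ideal_gen.induct)
    case (mult r a)
    then show ?case using S alg_gen.mult by (auto simp: mult.assoc)
  qed (auto simp: ring_distribs intro: alg_gen_0 g alg_gen.add)
  have pow: "a * tpow k \<in> alg_gen B" if "a \<in> ideal_pow n I k" for a k
    using that
  proof (induction k arbitrary: a)
    case 0
    then show ?case using S by auto
  next
    case (Suc k)
    then have "a \<in> ideal_gen (S_ring n) {a * b |a b. a \<in> I \<and> b \<in> ideal_pow n I k}" by simp
    then show ?case
    proof (induction rule: ideal_gen.induct)
      case (gen c)
      then obtain p q where c: "c = p * q" "p \<in> I" "q \<in> ideal_pow n I k" by blast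
      then have "(p * Var T) * (q * tpow k) \<in> alg_gen B"
        using I Suc.IH alg_gen.mult by blast
      moreover have "tpow (Suc k) = Var T * (tpow k :: (var, 'k) mpoly)"
        using tpow_simps(3)[of "Suc 0" k] by (simp add: tpow_simps(2))
      then have "(p * Var T) * (q * tpow k) = c * tpow (Suc k)"
        by (simp add: c mult_ac)
      ultimately show ?case by simp
    next
      case (mult r a)
      then show ?case using S alg_gen.mult by (auto simp: mult.assoc)
    qed (auto simp: ring_distribs intro: alg_gen_0 alg_gen.add)
  qed
  fix F assume F: "F \<in> rees n I"
  obtain N where N: "F = (\<Sum>k<N. t_coeff F k * tpow k)" using rees_decomp by blast
  have "(\<Sum>k<N. t_coeff F k * tpow k) \<in> alg_gen B"
    using F by (intro alg_gen_sum pow) (auto simp: rees_def)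
  then show "F \<in> alg_gen B" using N by simp
qed

end

section \<open>Closed labellings\<close>

lemma tau_edge:
  assumes "i < j"
  shows "tau_less (Poly_Mapping.single (X j) 1 + Poly_Mapping.single (Y i) 1)
    (Poly_Mapping.single (X i) 1 + Poly_Mapping.single (Y j) 1)" (is "tau_less ?m' ?m")
proof -
  have "lookup ?m' w = lookup ?m w" if "vgt w (X i)" for w
    using that assms by (cases w) (auto simp: lookup_add lookup_single when_def)
  moreover have "lookup ?m' (X i) < lookup ?m (X i)"
    using assms by (auto simp: lookup_add lookup_single when_def)
  ultimately show ?thesis unfolding tau_less_eq lex_less_def by blast
qed

lemma monic_lm_f_edge:
  assumes "i < j"
  shows "monic_lm (f_edge (i, j) :: (var, 'k::comm_ring_1) mpoly)
           (Poly_Mapping.single (X i) 1 + Poly_Mapping.single (Y j) 1)"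
proof -
  let ?m = "Poly_Mapping.single (X i) 1 + Poly_Mapping.single (Y j) (1::nat)"
  let ?m' = "Poly_Mapping.single (X j) 1 + Poly_Mapping.single (Y i) (1::nat)"
  have eq: "f_edge (i, j) = mon ?m + (- mon ?m' :: (var, 'k) mpoly)"
    by (simp add: f_edge_def Var_def mult_single)
  have "tau_less ?m' ?m" using tau_edge[OF assms] .
  then show ?thesis unfolding monic_lm_tail eq by (intro exI[of _ "- mon ?m'"]) auto
qed

lemma f_edge_in_S_ring: "1 \<le> i \<Longrightarrow> i < j \<Longrightarrow> j \<le> n \<Longrightarrow> f_edge (i, j) \<in> S_ring n"
  unfolding f_edge_def S_ring_def
  by (intro polys_in_diff polys_in_mult polys_in_Var) (auto simp: S_vars_def)

lemma init_sigma_f_edge: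
  assumes "1 \<le> i" "i < j" "j \<le> n"
  shows "init sigma_less (f_edge (i, j) :: (var, 'k::comm_ring_1) mpoly) = Var (X i) * Var (Y j)"
proof -
  have "init sigma_less (f_edge (i, j) :: (var, 'k) mpoly) = init tau_less (f_edge (i, j))"
    using f_edge_in_S_ring[OF assms] by (intro init_sigma[of _ "S_vars n"]) (auto simp: S_ring_def)
  then show ?thesis
    using monic_lm_f_edge[OF assms(2), where 'k = 'k]
    by (simp add: init_tau[OF monic_lm_is_lm] monic_lm_def Var_def mult_single)
qed

text \<open>All terms of a multiple of a monomial are divisible by it, and sums create no new
  terms.\<close>

lemma monomial_ideal_divides:
  assumes "f \<in> ideal_gen R (mon ` P)" "m \<in> keys f"
  shows "\<exists>p\<in>P. \<exists>q. m = p + q"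
  using assms
proof (induction arbitrary: m rule: ideal_gen.induct)
  case (gen b)
  then obtain p where "p \<in> P" "m = p + 0" by (auto split: if_splits)
  then show ?case by blast
next
  case (add a c)
  then show ?case using keys_add[of a c] by blast
next
  case (mult r a)
  then obtain k l where "m = k + l" "l \<in> keys a" using keys_mult[of r a] by blast
  with mult.IH obtain p q where "p \<in> P" "l = p + q" by blast
  then show ?case using \<open>m = k + l\<close> by (metis add.left_commute)
qed simp

text \<open>Turns the Groebner property into a source of edges: an element of \<open>J_G\<close>
  with known leading monomial forces an edge among the indices of that monomial.\<close>

lemma closed_graph_divides:
  fixes h :: "(var, 'k::field) mpoly"
  assumes E: "graph_on n E" and closed: "closed_graph TYPE('k) n E"
    and h: "h \<in> J_G n E" "monic_lm h m"
  shows "\<exists>(i, j)\<in>E. lookup m (X i) > 0 \<and> lookup m (Y j) > 0"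
proof -
  have edge: "1 \<le> i \<and> i < j \<and> j \<le> n" if "(i, j) \<in> E" for i j
    using E that by (auto simp: graph_on_def)
  have fE: "f_edge ` E \<subseteq> (S_ring n :: (var, 'k) mpoly set)"
    by (rule image_subsetI, clarsimp) (use edge in \<open>simp add: f_edge_in_S_ring\<close>)
  have "h \<in> S_ring n"
    using h(1) ideal_gen_subset_ring[OF fE[unfolded S_ring_def]] unfolding J_G_def S_ring_def
    by (rule subsetD[rotated])
  then have "init sigma_less h = mon m"
    using h(2) init_sigma[of h "S_vars n"]
    by (simp add: init_tau[OF monic_lm_is_lm] monic_lm_def S_ring_def)
  moreover have "h \<noteq> 0" using h(2) by (auto simp: monic_lm_def)
  ultimately have "mon m \<in> init_ideal sigma_less (S_ring n) (J_G n E :: (var, 'k) mpoly set)"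
    unfolding init_ideal_def using h(1) by (intro ideal_gen.gen CollectI exI[of _ h]) simp
  then have m: "mon m \<in> ideal_gen (S_ring n) (init sigma_less ` f_edge ` E :: (var, 'k) mpoly set)"
    using closed unfolding closed_graph_def is_groebner_basis_def J_G_def by blast
  let ?lm = "\<lambda>(i, j). Poly_Mapping.single (X i) 1 + Poly_Mapping.single (Y j) (1::nat)"
  have "init sigma_less (f_edge e) = (mon (?lm e) :: (var, 'k) mpoly)" if "e \<in> E" for e
    using that edge[of "fst e" "snd e"] init_sigma_f_edge[of "fst e" "snd e" n, where 'k = 'k]
    by (simp add: Var_def mult_single case_prod_beta)
  then have "init sigma_less ` f_edge ` E = (mon ` ?lm ` E :: (var, 'k) mpoly set)"
    unfolding image_image by (rule image_cong[OF refl])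
  with m obtain p q where "p \<in> ?lm ` E" "m = p + q"
    using monomial_ideal_divides[of "mon m :: (var, 'k) mpoly" "S_ring n" "?lm ` E" m]
    unfolding \<open>init sigma_less ` f_edge ` E = _\<close> by simp blast
  then obtain i j where "(i, j) \<in> E" "m = ?lm (i, j) + q" by (auto elim!: imageE)
  then show ?thesis by (intro bexI[of _ "(i, j)"]) (simp_all add: lookup_add)
qed

text \<open>The S-pair of f_ij and f_ik is, up to sign, y_i f_jk with leading monomial x_j y_i y_k.
  The edge obtained is (j, k) or (j, i), and the latter contradicts i < j.\<close>

lemma closed_graph_upper:
  assumes E: "graph_on n E" and closed: "closed_graph TYPE('k::field) n E"
    and e: "(i, j) \<in> E" "(i, k) \<in> E" "j < k"
  shows "(j, k) \<in> E"
proof -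
  have ijk: "1 \<le> i" "i < j" "k \<le> n" "i < k"
    using E e by (auto simp: graph_on_def)
  let ?h = "Var (Y i) * f_edge (j, k) :: (var, 'k) mpoly"
  have "?h = Var (Y j) * f_edge (i, k) - Var (Y k) * f_edge (i, j)"
    by (simp add: f_edge_def algebra_simps)
  moreover have "Var (Y j) * f_edge (i, k) - Var (Y k) * f_edge (i, j) \<in> (J_G n E :: (var, 'k) mpoly set)"
    unfolding J_G_def S_ring_def using e ijk
    by (intro ideal_gen_diff ideal_gen.mult ideal_gen.gen polys_in_Var) (auto simp: S_vars_def)
  ultimately have "?h \<in> J_G n E" by simp
  moreover have "monic_lm ?h (Poly_Mapping.single (Y i) 1 + (Poly_Mapping.single (X j) 1 + Poly_Mapping.single (Y k) 1))"
    unfolding mon_single[symmetric] by (intro monic_lm_mult monic_lm_mon monic_lm_f_edge e)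
  ultimately obtain p q where "(p, q) \<in> E" "p = j" "q = i \<or> q = k"
    using closed_graph_divides[OF E closed, of ?h]
    by (fastforce simp: lookup_add lookup_single when_def split: if_splits)
  then show ?thesis using E e ijk by (auto simp: graph_on_def)
qed

text \<open>The S-pair of f_ik and f_jk is x_k f_ij with leading monomial x_i x_k y_j. The edge
  obtained is (i, j) or (k, j), and the latter contradicts j < k.\<close>

lemma closed_graph_lower:
  assumes E: "graph_on n E" and closed: "closed_graph TYPE('k::field) n E"
    and e: "(i, k) \<in> E" "(j, k) \<in> E" "i < j"
  shows "(i, j) \<in> E"
proof -
  have ijk: "1 \<le> i" "j < k" "k \<le> n" "i < k"
    using E e by (auto simp: graph_on_def)
  let ?h = "Var (X k) * f_edge (i, j) :: (var, 'k) mpoly"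
  have "?h = Var (X j) * f_edge (i, k) - Var (X i) * f_edge (j, k)"
    by (simp add: f_edge_def algebra_simps)
  moreover have "Var (X j) * f_edge (i, k) - Var (X i) * f_edge (j, k) \<in> (J_G n E :: (var, 'k) mpoly set)"
    unfolding J_G_def S_ring_def using e ijk
    by (intro ideal_gen_diff ideal_gen.mult ideal_gen.gen polys_in_Var) (auto simp: S_vars_def)
  ultimately have "?h \<in> J_G n E" by simp
  moreover have "monic_lm ?h (Poly_Mapping.single (X k) 1 + (Poly_Mapping.single (X i) 1 + Poly_Mapping.single (Y j) 1))"
    unfolding mon_single[symmetric] by (intro monic_lm_mult monic_lm_mon monic_lm_f_edge e)
  ultimately obtain p q where "(p, q) \<in> E" "q = j" "p = k \<or> p = i"
    using closed_graph_divides[OF E closed, of ?h]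
    by (fastforce simp: lookup_add lookup_single when_def split: if_splits)
  then show ?thesis using E e ijk by (auto simp: graph_on_def)
qed

section \<open>Lifting relations among the initial monomials\<close>

fun wvar :: "rvar \<Rightarrow> (var \<Rightarrow>\<^sub>0 nat)" where
  "wvar (RX i) = Poly_Mapping.single (X i) 1"
| "wvar (RY i) = Poly_Mapping.single (Y i) 1"
| "wvar (RT i j) = Poly_Mapping.single (X i) 1 + (Poly_Mapping.single (Y j) 1 + Poly_Mapping.single T 1)"

text \<open>The exponent of the leading monomial of the image of \<open>m\<close> under
  \<open>psi\<close>, see \<open>monic_lm_monsub\<close>. The inner sum is the
  \<open>lookup m v\<close>-fold multiple of \<open>wvar v\<close>.\<close>

definition weight :: "(rvar \<Rightarrow>\<^sub>0 nat) \<Rightarrow> (var \<Rightarrow>\<^sub>0 nat)" where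
  "weight m = (\<Sum>v\<in>keys m. \<Sum>_<lookup m v. wvar v)"

lemma sum_const_add: "(\<Sum>_<a + b. c) = (\<Sum>_<a. c) + (\<Sum>_<(b::nat). c :: 'a :: comm_monoid_add)"
  by (induction b) (simp_all add: add_ac)

lemma weight_add: "weight (a + b) = weight a + weight b"
  unfolding weight_def by (rule setsum_keys_plus_distrib) (simp_all add: sum_const_add)

lemma weight_simps [simp]: "weight 0 = 0" "weight (Poly_Mapping.single v (Suc 0)) = wvar v"
  by (simp_all add: weight_def)

definition Rvars :: "nat \<Rightarrow> (nat \<times> nat) set \<Rightarrow> rvar set" where
  "Rvars n E = RX ` {1..n} \<union> RY ` {1..n} \<union> (\<lambda>(i, j). RT i j) ` E"

lemma Rvars_simps [simp]:
  "RX i \<in> Rvars n E \<longleftrightarrow> 1 \<le> i \<and> i \<le> n" "RY i \<in> Rvars n E \<longleftrightarrow> 1 \<le> i \<and> i \<le> n"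
  "RT i j \<in> Rvars n E \<longleftrightarrow> (i, j) \<in> E"
  by (auto simp: Rvars_def)

lemma R_ring_eq: "R_ring n E = polys_in (Rvars n E)"
  by (simp add: R_ring_def Rvars_def)

lemma R_tdeg_add: "R_tdeg (a + b) = R_tdeg a + R_tdeg b"
  unfolding R_tdeg_def by (rule setsum_keys_plus_distrib) (simp_all add: algebra_simps)

lemma R_tdeg_simps [simp]: "R_tdeg 0 = 0"
  "R_tdeg (Poly_Mapping.single (RX i) (Suc 0)) = 0" "R_tdeg (Poly_Mapping.single (RY i) (Suc 0)) = 0"
  "R_tdeg (Poly_Mapping.single (RT i j) (Suc 0)) = Suc 0"
  by (simp_all add: R_tdeg_def)

text \<open>A factor x_a of the weight comes from the variable x_a or from an edge variable with
  lower endpoint a. Applied to a second monomial of the same weight, this finds there a variable to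
  exchange with.\<close>

lemma weight_XD: "lookup (weight m) (X a) > 0 \<Longrightarrow> lookup m (RX a) > 0 \<or> (\<exists>j. lookup m (RT a j) > 0)"
proof (induction m rule: monomial_induct)
  case (add v m')
  show ?case
  proof (cases "lookup (weight m') (X a) > 0")
    case False
    then have "lookup (wvar v) (X a) > 0" using add.prems by (simp add: weight_add lookup_add)
    then show ?thesis by (cases v) (auto simp: lookup_add lookup_single when_def split: if_splits)
  qed (use add.IH in \<open>auto simp: lookup_add\<close>)
qed simp

lemma weight_YD: "lookup (weight m) (Y b) > 0 \<Longrightarrow> lookup m (RY b) > 0 \<or> (\<exists>i. lookup m (RT i b) > 0)"
proof (induction m rule: monomial_induct)
  case (add v m')
  show ?case
  proof (cases "lookup (weight m') (Y b) > 0")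
    case False
    then have "lookup (wvar v) (Y b) > 0" using add.prems by (simp add: weight_add lookup_add)
    then show ?thesis by (cases v) (auto simp: lookup_add lookup_single when_def split: if_splits)
  qed (use add.IH in \<open>auto simp: lookup_add\<close>)
qed simp

lemma weight_TD: "lookup (weight m) T > 0 \<Longrightarrow> \<exists>i j. lookup m (RT i j) > 0"
proof (induction m rule: monomial_induct)
  case (add v m')
  show ?case
  proof (cases "lookup (weight m') T > 0")
    case False
    then have "lookup (wvar v) T > 0" using add.prems by (simp add: weight_add lookup_add)
    then show ?thesis by (cases v) (auto simp: lookup_add lookup_single when_def split: if_splits)
  qed (use add.IH in \<open>auto simp: lookup_add\<close>)
qed simp

lemma weight_RTI:
  assumes "lookup m (RT i j) > 0"
  shows "lookup (weight m) (X i) > 0" "lookup (weight m) (Y j) > 0" "lookup (weight m) T > 0"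
proof -
  obtain m' where m: "m = Poly_Mapping.single (RT i j) 1 + m'" using single_split[OF assms] by blast
  show "lookup (weight m) (X i) > 0" "lookup (weight m) (Y j) > 0" "lookup (weight m) T > 0"
    unfolding m by (simp_all add: weight_add lookup_add)
qed

text \<open>Without edge variables, passing to the weight merely renames variables, so the weight
  determines the monomial. This is the base case of \<open>rel_weight_eq\<close>.\<close>

lemma weight_no_RT:
  assumes "\<And>i j. lookup m (RT i j) = 0"
  shows "lookup (weight m) (X a) = lookup m (RX a) \<and> lookup (weight m) (Y a) = lookup m (RY a)"
proof (induction m rule: monomial_induct)
  case (add v m')
  then show ?case using assms
    by (cases v) (auto simp: weight_add lookup_add lookup_single when_def in_keys_iff)
qed simp

lemma keys_weight:
  assumes "keys m \<subseteq> Rvars n E" "graph_on n E" shows "keys (weight m) \<subseteq> Tvars n"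
proof (induction m rule: monomial_induct)
  case (add v m')
  then have "v \<in> Rvars n E" using assms by blast
  have "keys (wvar v) \<subseteq> Tvars n"
  proof (cases v)
    case (RT i j)
    then have "1 \<le> i \<and> i < j \<and> j \<le> n" using \<open>v \<in> Rvars n E\<close> assms(2) by (auto simp: graph_on_def)
    then show ?thesis using RT by (simp add: Tvars_def S_vars_def keys_plus_nat)
  qed (use \<open>v \<in> Rvars n E\<close> in \<open>simp_all add: Tvars_def S_vars_def\<close>)
  then show ?case using add by (simp add: weight_add keys_plus_nat)
qed simp

lemma monic_lm_monsub:
  assumes "keys m \<subseteq> Rvars n E" "graph_on n E"
  shows "monic_lm (monsub psi_img m :: (var, 'k::comm_ring_1) mpoly) (weight m)"
proof (induction m rule: monomial_induct)
  case zero
  then show ?case using monic_lm_mon[of 0] by simp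
next
  case (add v m')
  then have v: "v \<in> Rvars n E" using assms by blast
  have "monic_lm (psi_img v :: (var, 'k) mpoly) (wvar v)"
  proof (cases v)
    case (RT i j)
    then have "i < j" using v assms(2) by (auto simp: graph_on_def)
    then have "monic_lm (f_edge (i, j) * Var T :: (var, 'k) mpoly)
       ((Poly_Mapping.single (X i) 1 + Poly_Mapping.single (Y j) 1) + Poly_Mapping.single T 1)"
      unfolding mon_single[symmetric] by (intro monic_lm_mult monic_lm_mon monic_lm_f_edge)
    then show ?thesis using RT by (simp add: add.assoc)
  qed (simp_all add: Var_def monic_lm_mon)
  then show ?case using add monic_lm_mult by (simp add: monsub_add weight_add)
qed

lemma psi_single: "psi (Poly_Mapping.single m c) = Const c * monsub psi_img m"
  by (simp add: psi_def subst_single)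

lemma psi_simps: "psi (F + G) = psi F + psi G" "psi (F - G) = psi F - psi G" "psi (F * G) = psi F * psi G"
  "psi 0 = 0" "psi (Var v) = psi_img v" "psi (Const c) = Const c" "psi (- F) = - psi F"
  by (simp_all add: psi_def subst_add subst_diff subst_mult subst_Var subst_Const subst_uminus)

lemma psi_keys_less:
  assumes F: "F \<in> R_ring n E" "graph_on n E" and less: "\<And>v. v \<in> keys F \<Longrightarrow> tau_less (weight v) \<mu>"
    and p: "p \<in> keys (psi F)"
  shows "tau_less p \<mu>"
proof -
  have "p \<in> keys (psi F) \<longrightarrow> tau_less p \<mu>"
  proof (induction F rule: mpoly_induct)
    case (add F G)
    then show ?case using keys_add[of "psi F" "psi G"] by (auto simp: psi_simps)
  next
    case (single m c)
    then have "keys m \<subseteq> Rvars n E" using F by (auto simp: R_ring_eq polys_in_iff)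
    then have lm: "monic_lm (monsub psi_img m :: (var, 'a) mpoly) (weight m)"
      using monic_lm_monsub F(2) by blast
    show ?case
    proof
      assume "p \<in> keys (psi (Poly_Mapping.single m c))"
      then have "p \<in> keys (monsub psi_img m :: (var, 'a) mpoly)"
        using keys_mult[of "Const c" "monsub psi_img m"] by (auto simp: psi_single Const_def split: if_splits)
      then have "p = weight m \<or> tau_less p (weight m)"
        using lm by (auto simp: monic_lm_def)
      then show "tau_less p \<mu>" using less[OF single] tau_trans by blast
    qed
  qed (simp add: psi_simps)
  then show ?thesis using p by blast
qed

text \<open>All terms other than \<open>u\<close> have images strictly below
  \<open>weight u\<close>, so nothing cancels the top term.\<close>

lemma is_lm_psi:
  assumes F: "F \<in> R_ring n E" "graph_on n E" and u: "u \<in> keys F"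
    and less: "\<And>v. v \<in> keys F \<Longrightarrow> v \<noteq> u \<Longrightarrow> tau_less (weight v) (weight u)"
  shows "is_lm (psi F) (weight u)"
proof -
  let ?c = "lookup F u"
  define G where "G = F - Poly_Mapping.single u ?c"
  have uR: "keys u \<subseteq> Rvars n E" using F u by (auto simp: R_ring_eq polys_in_iff)
  have keysG: "keys G \<subseteq> keys F - {u}"
    by (auto simp: G_def in_keys_iff lookup_minus lookup_single when_def split: if_splits)
  have "G \<in> R_ring n E" using F keysG by (auto simp: R_ring_eq polys_in_iff)
  then have small: "tau_less p (weight u)" if "p \<in> keys (psi G)" for p
    using psi_keys_less[OF _ F(2) _ that] less keysG by blast
  obtain h :: "(var, 'a) mpoly" where h: "monsub psi_img u = mon (weight u) + h"
      "\<And>p. p \<in> keys h \<Longrightarrow> tau_less p (weight u)"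
    using monic_lm_monsub[OF uR F(2), where 'k = 'a] unfolding monic_lm_tail by blast
  have ch: "tau_less p (weight u)" if "p \<in> keys (Const ?c * h)" for p
    using that keys_mult[of "Const ?c" h] h(2) by (auto simp: Const_def split: if_splits)
  have F_eq: "F = Poly_Mapping.single u ?c + G" by (simp add: G_def)
  have "psi F = Poly_Mapping.single (weight u) ?c + (Const ?c * h + psi G)"
    by (subst F_eq) (simp add: psi_simps psi_single h(1) ring_distribs Const_mult_mono add.assoc)
  moreover have tl: "tau_less p (weight u)" if "p \<in> keys (Const ?c * h + psi G)" for p
    using that keys_add[of "Const ?c * h" "psi G"] ch small by blast
  moreover from tl[of "weight u"] have "lookup (Const ?c * h + psi G) (weight u) = 0"
    using tau_irrefl by (auto simp: in_keys_iff)
  ultimately show ?thesis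
    using u keys_add[of "Poly_Mapping.single (weight u) ?c" "Const ?c * h + psi G"]
    unfolding is_lm_def by (auto simp: in_keys_iff[of "weight u"] in_keys_iff[of u] lookup_add)
qed

text \<open>Replacing x_i y_j by x_j y_i inside a monomial lowers it when i < j; every correction
  term below is smaller for this reason. The equations as hypotheses leave the rearrangement of
  summands to the caller.\<close>

lemma tau_edge_add:
  assumes "i < j" "a = Poly_Mapping.single (X j) 1 + Poly_Mapping.single (Y i) 1 + c"
    "b = Poly_Mapping.single (X i) 1 + Poly_Mapping.single (Y j) 1 + c"
  shows "tau_less a b"
  unfolding assms(2,3) using tau_edge[OF assms(1)] by (simp only: add.commute[of _ c] tau_add)

lemma single_split2:
  assumes "lookup m v > 0" "lookup m v' > 0" "v \<noteq> v'"
  shows "\<exists>r. m = Poly_Mapping.single v 1 + Poly_Mapping.single v' (1::nat) + r"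
proof -
  obtain r where r: "m = Poly_Mapping.single v 1 + r" using single_split[OF assms(1)] by blast
  have pos: "lookup r v' > 0" using assms(2,3) unfolding r by (simp add: lookup_add lookup_single when_def)
  obtain s where s: "r = Poly_Mapping.single v' 1 + s" using single_split[OF pos] by blast
  show ?thesis unfolding r s by (rule exI[of _ s]) (rule add.assoc[symmetric])
qed

lemma single_split3:
  assumes "lookup m v > 0" "lookup m v' > 0" "lookup m v'' > 0" "v \<noteq> v'" "v \<noteq> v''" "v' \<noteq> v''"
  shows "\<exists>r. m = Poly_Mapping.single v 1 + Poly_Mapping.single v' 1 + Poly_Mapping.single v'' (1::nat) + r"
proof -
  obtain r where r: "m = Poly_Mapping.single v 1 + Poly_Mapping.single v' 1 + r"
    using single_split2[OF assms(1,2,4)] by blast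
  have pos: "lookup r v'' > 0" using assms(3,5,6) unfolding r by (simp add: lookup_add lookup_single when_def)
  obtain s where s: "r = Poly_Mapping.single v'' 1 + s" using single_split[OF pos] by blast
  show ?thesis unfolding r s by (rule exI[of _ s]) (simp only: add.assoc)
qed

text \<open>From here on closedness is represented by \<open>upper\<close> and \<open>lower\<close>.
  Carrying \<open>L\<close> as a parameter fixes the field \<open>'k\<close>.\<close>

locale closed_edges =
  fixes n :: nat and E :: "(nat \<times> nat) set" and L :: "(rvar, 'k::field) mpoly set"
  assumes E: "graph_on n E"
    and upper: "\<And>i j k. (i, j) \<in> E \<Longrightarrow> (i, k) \<in> E \<Longrightarrow> j < k \<Longrightarrow> (j, k) \<in> E"
    and lower: "\<And>i j k. (i, k) \<in> E \<Longrightarrow> (j, k) \<in> E \<Longrightarrow> i < j \<Longrightarrow> (i, j) \<in> E"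
    and L_def: "L = ideal_gen (R_ring n E) {F \<in> ker_psi n E. \<forall>m\<in>keys F. R_tdeg m \<le> 2}"
begin

abbreviation x :: "nat \<Rightarrow> rvar \<Rightarrow>\<^sub>0 nat" where "x i \<equiv> Poly_Mapping.single (RX i) 1"
abbreviation y :: "nat \<Rightarrow> rvar \<Rightarrow>\<^sub>0 nat" where "y i \<equiv> Poly_Mapping.single (RY i) 1"
abbreviation t :: "nat \<Rightarrow> nat \<Rightarrow> rvar \<Rightarrow>\<^sub>0 nat" where "t i j \<equiv> Poly_Mapping.single (RT i j) 1"

lemma edgeD: "(i, j) \<in> E \<Longrightarrow> 1 \<le> i \<and> i < j \<and> j \<le> n \<and> 1 \<le> j \<and> i \<le> n"
  using E by (fastforce simp: graph_on_def)

lemma L_props: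
  "0 \<in> L" "F \<in> L \<Longrightarrow> G \<in> L \<Longrightarrow> F + G \<in> L" "F \<in> L \<Longrightarrow> - F \<in> L"
  "F \<in> R_ring n E \<Longrightarrow> G \<in> L \<Longrightarrow> F * G \<in> L"
  unfolding L_def R_ring_eq by (auto intro: ideal_gen.intros ideal_gen_uminus)

text \<open>The relation \<open>u - v\<close> of leading monomials lifts to an element of \<open>L\<close>.\<close>

definition rel :: "(rvar \<Rightarrow>\<^sub>0 nat) \<Rightarrow> (rvar \<Rightarrow>\<^sub>0 nat) \<Rightarrow> bool" where
  "rel u v \<longleftrightarrow> weight u = weight v \<and>
     (\<exists>G\<in>R_ring n E. (\<forall>g\<in>keys G. tau_less (weight g) (weight u)) \<and> mon u - mon v - G \<in> L)"

lemma relI: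
  assumes "weight u = weight v" "G \<in> R_ring n E" "\<And>g. g \<in> keys G \<Longrightarrow> tau_less (weight g) (weight u)"
    and "mon u - mon v - G \<in> L"
  shows "rel u v"
  unfolding rel_def using assms by blast

lemma rel_refl: "rel u u"
  unfolding rel_def by (auto intro!: bexI[of _ 0] simp: L_props R_ring_eq)

lemma rel_sym:
  assumes "rel u v" shows "rel v u"
proof -
  obtain G where G: "weight u = weight v" "G \<in> R_ring n E" "\<And>g. g \<in> keys G \<Longrightarrow> tau_less (weight g) (weight u)"
      "mon u - mon v - G \<in> L"
    using assms unfolding rel_def by blast
  have "- G \<in> R_ring n E" using G(2) by (simp add: R_ring_eq polys_in_iff)
  moreover have "mon v - mon u - (- G) = - (mon u - mon v - G)" by simp
  then have "mon v - mon u - (- G) \<in> L" using L_props(3)[OF G(4)] by (simp only:)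
  moreover have "tau_less (weight g) (weight v)" if "g \<in> keys (- G)" for g
    using that G(1,3) by simp
  ultimately show ?thesis
    using relI[of v u "- G"] G(1) by simp
qed

lemma rel_trans:
  assumes "rel u v" "rel v z" shows "rel u z"
proof -
  obtain G where G: "weight u = weight v" "G \<in> R_ring n E" "\<And>g. g \<in> keys G \<Longrightarrow> tau_less (weight g) (weight u)"
      "mon u - mon v - G \<in> L"
    using assms(1) unfolding rel_def by blast
  obtain H where H: "weight v = weight z" "H \<in> R_ring n E" "\<And>g. g \<in> keys H \<Longrightarrow> tau_less (weight g) (weight v)"
      "mon v - mon z - H \<in> L"
    using assms(2) unfolding rel_def by blast
  have "G + H \<in> R_ring n E" using G(2) H(2) by (simp add: R_ring_eq polys_in_add)
  moreover have "mon u - mon z - (G + H) = (mon u - mon v - G) + (mon v - mon z - H)" by simp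
  then have "mon u - mon z - (G + H) \<in> L" using L_props(2)[OF G(4) H(4)] by (simp only:)
  moreover have "tau_less (weight g) (weight u)" if "g \<in> keys (G + H)" for g
    using that keys_add[of G H] G(1,3) H(3) by auto
  ultimately show ?thesis
    using relI[of u z "G + H"] G(1) H(1) by simp
qed

text \<open>The ideal \<open>L\<close> absorbs monomials of R and \<open>tau_less\<close> is
  translation invariant. An exchange between small monomials can therefore be carried out inside
  larger ones.\<close>

lemma rel_add:
  assumes "rel u v" and p: "keys p \<subseteq> Rvars n E" shows "rel (p + u) (p + v)"
proof -
  obtain G where G: "weight u = weight v" "G \<in> R_ring n E" "\<And>g. g \<in> keys G \<Longrightarrow> tau_less (weight g) (weight u)"
      "mon u - mon v - G \<in> L"
    using assms(1) unfolding rel_def by blast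
  have p': "mon p \<in> R_ring n E" using p by (auto simp: R_ring_eq intro: polys_in_single)
  then have "mon p * G \<in> R_ring n E" using G(2) unfolding R_ring_eq by (rule polys_in_mult)
  moreover have "mon (p + u) - mon (p + v) - mon p * G = mon p * (mon u - mon v - G)"
    by (simp add: algebra_simps mult_single)
  then have "mon (p + u) - mon (p + v) - mon p * G \<in> L" using L_props(4)[OF p' G(4)] by (simp only:)
  moreover have "tau_less (weight g) (weight (p + u))" if g: "g \<in> keys (mon p * G)" for g
  proof -
    obtain g' where "g' \<in> keys G" "g = p + g'"
      using g keys_mult[of "mon p" G] by auto
    then show ?thesis using G(3) by (simp add: weight_add tau_add)
  qed
  ultimately show ?thesis
    using relI[of "p + u" "p + v" "mon p * G"] G(1) by (simp add: weight_add)
qed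

text \<open>Reduces a lift to naming the correction \<open>G\<close> and checking one polynomial
  identity: \<open>mon u - mon v - G\<close> is then itself a generator of \<open>L\<close>.\<close>

lemma rel_by_kernel:
  fixes G :: "(rvar, 'k) mpoly"
  assumes "weight u = weight v" "keys u \<subseteq> Rvars n E" "keys v \<subseteq> Rvars n E"
    and "R_tdeg u \<le> 2" "R_tdeg v \<le> 2"
    and G: "\<And>g. g \<in> keys G \<Longrightarrow> keys g \<subseteq> Rvars n E \<and> R_tdeg g \<le> 2 \<and> tau_less (weight g) (weight u)"
    and psi: "psi (mon u - mon v - G) = 0"
  shows "rel u v"
proof -
  have GR: "G \<in> R_ring n E" using G by (auto simp: R_ring_eq polys_in_iff)
  have "mon u - mon v - G \<in> R_ring n E"
    using GR assms(2,3) polys_in_diff polys_in_single unfolding R_ring_eq by metis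
  then have "mon u - mon v - G \<in> ker_psi n E" using psi by (simp add: ker_psi_def)
  moreover have "R_tdeg m \<le> 2" if "m \<in> keys (mon u - mon v - G)" for m
  proof -
    have "m \<in> keys (mon u :: (rvar, 'k) mpoly) \<union> keys (mon v :: (rvar, 'k) mpoly) \<union> keys G"
      using that keys_diff[of "mon u - mon v" G] keys_diff[of "mon u" "mon v :: (rvar, 'k) mpoly"] by blast
    then consider "m = u" | "m = v" | "m \<in> keys G" by auto
    then show ?thesis using assms(4,5) G[of m] by cases simp_all
  qed
  ultimately have "mon u - mon v - G \<in> L" unfolding L_def by (intro ideal_gen.gen CollectI conjI ballI)
  moreover have "tau_less (weight g) (weight u)" if "g \<in> keys G" for g using G[OF that] by blast
  ultimately show ?thesis by (intro relI[OF assms(1) GR])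
qed

section \<open>The four elementary exchanges\<close>

lemmas mon_simps = mon_add mon_single psi_simps f_edge_def

text \<open>The Koszul relation f_ab t_ij = f_ij t_ab, with the non-leading terms of both binomials
  collected in \<open>?G\<close>.\<close>

lemma rel_xy:
  assumes "(a, b) \<in> E" "(i, j) \<in> E"
  shows "rel (x a + y b + t i j) (x i + y j + t a b)"
proof (rule rel_by_kernel)
  let ?G = "mon (x b + y a + t i j) - mon (x j + y i + t a b) :: (rvar, 'k) mpoly"
  note e = edgeD[OF assms(1)] edgeD[OF assms(2)]
  show "keys g \<subseteq> Rvars n E \<and> R_tdeg g \<le> 2 \<and> tau_less (weight g) (weight (x a + y b + t i j))"
    if "g \<in> keys ?G" for g
  proof -
    have "g = x b + y a + t i j \<or> g = x j + y i + t a b"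
      using that keys_diff[of "mon (x b + y a + t i j)" "mon (x j + y i + t a b) :: (rvar, 'k) mpoly"] by auto
    moreover have "tau_less (weight (x b + y a + t i j)) (weight (x a + y b + t i j))"
      by (rule tau_edge_add[of a b _ "wvar (RT i j)"]) (use e in \<open>auto simp: weight_add add_ac\<close>)
    moreover have "tau_less (weight (x j + y i + t a b)) (weight (x a + y b + t i j))"
      by (rule tau_edge_add[of i j _ "wvar (RT a b)"]) (use e in \<open>auto simp: weight_add add_ac\<close>)
    ultimately show ?thesis using e assms by (auto simp: keys_plus_nat R_tdeg_add)
  qed
  show "psi (mon (x a + y b + t i j) - mon (x i + y j + t a b) - ?G) = 0"
    unfolding mon_simps by (simp add: f_edge_def algebra_simps)
qed (use assms edgeD in \<open>auto simp: weight_add add_ac keys_plus_nat R_tdeg_add\<close>)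

text \<open>For i < a this is the syzygy x_a f_ib - x_i f_ab - x_b f_ia = 0, the expansion of a 3 by
  3 determinant with the row of x repeated. The edge (i, a) of the correction comes from
  \<open>lower\<close>.\<close>

lemma rel_x:
  assumes "(a, b) \<in> E" "(i, b) \<in> E"
  shows "rel (x a + t i b) (x i + t a b)"
proof -
  have main: "rel (x a + t i b) (x i + t a b)" if "(a, b) \<in> E" "(i, b) \<in> E" "i < a" for a i
  proof (rule rel_by_kernel)
    let ?G = "mon (x b + t i a) :: (rvar, 'k) mpoly"
    note e = edgeD[OF that(1)] edgeD[OF that(2)]
    have ia: "(i, a) \<in> E" using lower that by blast
    have "tau_less (weight (x b + t i a)) (weight (x a + t i b))"
      by (rule tau_edge_add[of a b _ "wvar (RX i) + Poly_Mapping.single T 1"]) (use e in \<open>auto simp: weight_add add_ac\<close>)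
    then show "keys g \<subseteq> Rvars n E \<and> R_tdeg g \<le> 2 \<and> tau_less (weight g) (weight (x a + t i b))"
      if "g \<in> keys ?G" for g
      using that e ia by (auto simp: keys_plus_nat R_tdeg_add)
    show "psi (mon (x a + t i b) - mon (x i + t a b) - ?G) = 0"
      unfolding mon_simps by (simp add: f_edge_def algebra_simps)
  qed (use that edgeD in \<open>auto simp: weight_add add_ac keys_plus_nat R_tdeg_add\<close>)
  consider "i < a" | "i = a" | "a < i" by linarith
  then show ?thesis using main assms rel_sym rel_refl by cases blast+
qed

text \<open>The counterpart of \<open>rel_x\<close> with the row of y repeated: y_b f_aj - y_j f_ab
  - y_a f_bj = 0 for b < j. The edge (b, j) comes from \<open>upper\<close>.\<close>

lemma rel_y:
  assumes "(a, b) \<in> E" "(a, j) \<in> E"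
  shows "rel (y b + t a j) (y j + t a b)"
proof -
  have main: "rel (y b + t a j) (y j + t a b)" if "(a, b) \<in> E" "(a, j) \<in> E" "b < j" for b j
  proof (rule rel_by_kernel)
    let ?G = "mon (y a + t b j) :: (rvar, 'k) mpoly"
    note e = edgeD[OF that(1)] edgeD[OF that(2)]
    have bj: "(b, j) \<in> E" using upper that by blast
    have "tau_less (weight (y a + t b j)) (weight (y b + t a j))"
      by (rule tau_edge_add[of a b _ "wvar (RY j) + Poly_Mapping.single T 1"]) (use e in \<open>auto simp: weight_add add_ac\<close>)
    then show "keys g \<subseteq> Rvars n E \<and> R_tdeg g \<le> 2 \<and> tau_less (weight g) (weight (y b + t a j))"
      if "g \<in> keys ?G" for g
      using that e bj by (auto simp: keys_plus_nat R_tdeg_add)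
    show "psi (mon (y b + t a j) - mon (y j + t a b) - ?G) = 0"
      unfolding mon_simps by (simp add: f_edge_def algebra_simps)
  qed (use that edgeD in \<open>auto simp: weight_add add_ac keys_plus_nat R_tdeg_add\<close>)
  consider "b < j" | "b = j" | "j < b" by linarith
  then show ?thesis using main assms rel_sym rel_refl by cases blast+
qed

text \<open>For i < a < j < b this is the Plucker relation f_ab f_ij - f_aj f_ib = f_ia f_jb. Its
  right side involves edges, (i, a) by \<open>lower\<close> and (j, b) by \<open>upper\<close>, and
  is smaller because x_a y_j has become x_j y_a.\<close>

lemma rel_t:
  assumes "(a, b) \<in> E" "(a, j) \<in> E" "(i, b) \<in> E" "(i, j) \<in> E"
  shows "rel (t a b + t i j) (t a j + t i b)"
proof -
  have main: "rel (t a b + t i j) (t a j + t i b)"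
    if "(a, b) \<in> E" "(a, j) \<in> E" "(i, b) \<in> E" "(i, j) \<in> E" "i < a" "j < b" for a b i j
  proof (rule rel_by_kernel)
    let ?G = "mon (t i a + t j b) :: (rvar, 'k) mpoly"
    note e = edgeD[OF that(1)] edgeD[OF that(2)] edgeD[OF that(3)] edgeD[OF that(4)]
    have ia: "(i, a) \<in> E" using lower that by blast
    have jb: "(j, b) \<in> E" using upper that by blast
    have "tau_less (weight (t i a + t j b)) (weight (t a b + t i j))"
      by (rule tau_edge_add[of a j _ "wvar (RX i) + wvar (RY b) + Poly_Mapping.single T 1 + Poly_Mapping.single T 1"])
        (use e in \<open>auto simp: weight_add add_ac\<close>)
    then show "keys g \<subseteq> Rvars n E \<and> R_tdeg g \<le> 2 \<and> tau_less (weight g) (weight (t a b + t i j))"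
      if "g \<in> keys ?G" for g
      using that e ia jb by (auto simp: keys_plus_nat R_tdeg_add)
    show "psi (mon (t a b + t i j) - mon (t a j + t i b) - ?G) = 0"
      unfolding mon_simps by (simp add: f_edge_def algebra_simps)
  qed (use that edgeD in \<open>auto simp: weight_add add_ac keys_plus_nat R_tdeg_add\<close>)
  \<comment> \<open>The other strict orders are this one after renaming or exchanging sides; if i =
    a or j = b, both sides are the same monomial.\<close>
  consider "i < a" "j < b" | "i < a" "b < j" | "a < i" "j < b" | "a < i" "b < j" | "i = a \<or> j = b"
    by linarith
  then show ?thesis
  proof cases
    case 1
    then show ?thesis using main assms by blast
  next
    case 2
    then show ?thesis using main[of a j b i] assms rel_sym by blast
  next
    case 3
    then show ?thesis using main[of i b j a] assms rel_sym by (simp add: add.commute)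
  next
    case 4
    then show ?thesis using main[of i j b a] assms by (simp add: add.commute)
  next
    case 5
    then show ?thesis using rel_refl by (auto simp: add.commute)
  qed
qed

section \<open>The exchange argument\<close>

lemma keysD: "lookup m v > (0::nat) \<Longrightarrow> keys m \<subseteq> Rvars n E \<Longrightarrow> v \<in> Rvars n E"
  by (auto simp: in_keys_iff dest!: subsetD[of _ _ v])

text \<open>Up to \<open>rel\<close>, the edge variable \<open>t i j\<close> can be split off from \<open>m\<close>.\<close>

definition exposes :: "(rvar \<Rightarrow>\<^sub>0 nat) \<Rightarrow> nat \<Rightarrow> nat \<Rightarrow> bool" where
  "exposes m i j \<longleftrightarrow> (i, j) \<in> E \<and> (\<exists>m'. keys m' \<subseteq> Rvars n E \<and> rel m (t i j + m'))"

lemma exposes_self: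
  assumes "lookup m (RT i j) > 0" "keys m \<subseteq> Rvars n E" shows "exposes m i j"
proof -
  obtain m' where m': "m = t i j + m'" using single_split[OF assms(1)] by blast
  moreover have "(i, j) \<in> E" using keysD[OF assms] by simp
  ultimately show ?thesis
    unfolding exposes_def using assms(2) rel_refl by (auto simp: keys_plus_nat)
qed

lemma exposesI:
  assumes "rel q (q' + t i j)" "m = q + r" "keys m \<subseteq> Rvars n E" "keys q' \<subseteq> Rvars n E"
    and "(i, j) \<in> E"
  shows "exposes m i j"
proof -
  have "keys r \<subseteq> Rvars n E" using assms(2,3) by (simp add: keys_plus_nat)
  then have "rel (r + q) (r + (q' + t i j))" using rel_add assms(1) by blast
  then have "rel m (t i j + (r + q'))" by (simp add: assms(2) add_ac)
  moreover have "keys (r + q') \<subseteq> Rvars n E" using \<open>keys r \<subseteq> _\<close> assms(4) by (simp add: keys_plus_nat)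
  ultimately show ?thesis unfolding exposes_def using assms(5) by blast
qed

text \<open>The product x_a y_b lacks only the factor t of the weight of the edge (a, b); any edge
  variable present in \<open>m\<close> supplies it.\<close>

lemma exposes_xy:
  assumes m: "keys m \<subseteq> Rvars n E"
    and l: "lookup m (RX a) > 0" "lookup m (RY b) > 0" "lookup m (RT i j) > 0" and ab: "(a, b) \<in> E"
  shows "exposes m a b"
proof -
  have "RX a \<noteq> RY b" "RX a \<noteq> RT i j" "RY b \<noteq> RT i j" by simp_all
  then obtain r where "m = x a + y b + t i j + r" using single_split3[OF l] by blast
  moreover have ij: "(i, j) \<in> E" using keysD[OF l(3) m] by simp
  ultimately show ?thesis using rel_xy[OF ab ij] m ab edgeD[OF ij]
    by (intro exposesI[of _ "x i + y j"]) (auto simp: keys_plus_nat)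
qed

lemma exposes_x:
  assumes m: "keys m \<subseteq> Rvars n E"
    and l: "lookup m (RX a) > 0" "lookup m (RT i b) > 0" and ab: "(a, b) \<in> E"
  shows "exposes m a b"
proof -
  have "RX a \<noteq> RT i b" by simp
  then obtain r where "m = x a + t i b + r" using single_split2[OF l] by blast
  moreover have ij: "(i, b) \<in> E" using keysD[OF l(2) m] by simp
  ultimately show ?thesis using rel_x[OF ab ij] m ab edgeD[OF ij]
    by (intro exposesI[of _ "x i"]) (auto simp: keys_plus_nat)
qed

lemma exposes_y:
  assumes m: "keys m \<subseteq> Rvars n E"
    and l: "lookup m (RY b) > 0" "lookup m (RT a j) > 0" and ab: "(a, b) \<in> E"
  shows "exposes m a b"
proof -
  have "RY b \<noteq> RT a j" by simp
  then obtain r where "m = y b + t a j + r" using single_split2[OF l] by blast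
  moreover have ij: "(a, j) \<in> E" using keysD[OF l(2) m] by simp
  ultimately show ?thesis using rel_y[OF ab ij] m ab edgeD[OF ij]
    by (intro exposesI[of _ "y j"]) (auto simp: keys_plus_nat)
qed

text \<open>Swapping endpoints produces two edge variables at once, so (i, j) has to be an edge as
  well as (a, b).\<close>

lemma exposes_t:
  assumes m: "keys m \<subseteq> Rvars n E"
    and l: "lookup m (RT a j) > 0" "lookup m (RT i b) > 0" and ab: "(a, b) \<in> E" "(i, j) \<in> E"
  shows "exposes m a b"
proof (cases "(a, j) = (i, b)")
  case True
  then show ?thesis using exposes_self l m by auto
next
  case False
  then have "RT a j \<noteq> RT i b" by simp
  then obtain r where "m = t a j + t i b + r" using single_split2[OF l] by blast
  moreover have ij: "(a, j) \<in> E" "(i, b) \<in> E" using keysD[OF l(1) m] keysD[OF l(2) m] by simp_all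
  moreover have "rel (t a j + t i b) (t i j + t a b)"
    using rel_t[of a j b i] ij ab by (simp add: add.commute)
  ultimately show ?thesis using m ab
    by (intro exposesI[of _ "t i j"]) (auto simp: keys_plus_nat)
qed

text \<open>
  Taking the edge \<open>(a, b)\<close> of \<open>v\<close> with \<open>a + b\<close> minimal ensures that in the two configurations where
  \<open>(a, b)\<close> cannot be exposed in \<open>u\<close>, an edge of \<open>u\<close> can be exposed in \<open>v\<close> instead.
\<close>

lemma common_edge:
  assumes u: "keys u \<subseteq> Rvars n E" and v: "keys v \<subseteq> Rvars n E" and w: "weight u = weight v"
    and T: "lookup (weight u) T > 0"
  shows "\<exists>i j. exposes u i j \<and> exposes v i j"
proof -
  have "\<exists>e. lookup v (RT (fst e) (snd e)) > 0" using weight_TD[of v] T w by auto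
  then obtain e where e: "lookup v (RT (fst e) (snd e)) > 0"
    and min_e: "\<And>e'. lookup v (RT (fst e') (snd e')) > 0 \<Longrightarrow> fst e + snd e \<le> fst e' + snd e'"
    using ex_has_least_nat[of "\<lambda>e. lookup v (RT (fst e) (snd e)) > 0" _ "\<lambda>e. fst e + snd e"] by blast
  define a b where "a = fst e" and "b = snd e"
  have vab: "lookup v (RT a b) > 0" using e by (simp add: a_def b_def)
  have min: "a + b \<le> i + j" if "lookup v (RT i j) > 0" for i j
    using min_e[of "(i, j)"] that by (simp add: a_def b_def)
  have ab: "(a, b) \<in> E" using keysD[OF vab v] by simp
  have vexp: "exposes v a b" using exposes_self vab v by blast
  have uX: "lookup u (RX a) > 0 \<or> (\<exists>j. lookup u (RT a j) > 0)"
    and uY: "lookup u (RY b) > 0 \<or> (\<exists>i. lookup u (RT i b) > 0)"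
    using weight_RTI[OF vab] w weight_XD weight_YD by metis+
  obtain k l where kl: "lookup u (RT k l) > 0" using weight_TD T by blast
  consider "lookup u (RX a) > 0" "lookup u (RY b) > 0"
    | i where "lookup u (RX a) > 0" "lookup u (RT i b) > 0"
    | j where "lookup u (RY b) > 0" "lookup u (RT a j) > 0"
    | i j where "lookup u (RT a j) > 0" "lookup u (RT i b) > 0"
    using uX uY by (elim disjE exE) (metis that)+
  then show ?thesis
  proof cases
    case 1
    then show ?thesis using exposes_xy[OF u _ _ kl ab] vexp by blast
  next
    case 2
    then show ?thesis using exposes_x[OF u _ _ ab] vexp by blast
  next
    case 3
    then show ?thesis using exposes_y[OF u _ _ ab] vexp by blast
  next
    case (4 i j)
    have aj: "(a, j) \<in> E" and ib: "(i, b) \<in> E" using keysD[OF 4(1) u] keysD[OF 4(2) u] by simp_all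
    have lt: "a < b" "a < j" "i < b" using edgeD ab aj ib by blast+
    \<comment> \<open>Swapping in \<open>u\<close> leaves t_ij beside t_ab. The pair (i, j) is an
      edge in the first two strict cases. It may fail to be one in the last two: the interval from i
      to j may be too wide in the former, and i >= j may hold in the latter.\<close>
    consider "i = a \<or> j = b" | "i < a" "j < b" | "a < i" "b < j" | "i < a" "b < j" | "a < i" "j < b"
      by linarith
    then show ?thesis
    proof cases
      case 1
      then show ?thesis using exposes_self[of u a b] 4 u vexp by auto
    next
      case 2
      then have "(i, j) \<in> E" using lower[OF ib upper[OF aj ab]] lt by simp
      then show ?thesis using exposes_t[OF u 4 ab] vexp by blast
    next
      case 3
      then have "(i, j) \<in> E" using upper[OF lower[OF ab ib] aj] lt by simp
      then show ?thesis using exposes_t[OF u 4 ab] vexp by blast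
    next
      case c: 4
      have uib: "exposes u i b" using exposes_self 4(2) u by blast
      consider "lookup v (RX i) > 0" | l where "lookup v (RT i l) > 0"
        using weight_RTI(1)[OF 4(2)] w weight_XD by metis
      then show ?thesis
      proof cases
        case 1
        then show ?thesis using exposes_x[OF v 1 vab ib] uib by blast
      next
        case (2 l)
        have il: "(i, l) \<in> E" using keysD[OF 2 v] by simp
        \<comment> \<open>Since i < a, minimality of a + b excludes l < b. The rules then give (i,
          a) and (a, l), so swapping t_il t_ab in \<open>v\<close> yields t_ib.\<close>
        have "b \<le> l" using min[OF 2] c by linarith
        have "(a, l) \<in> E"
        proof (cases "l = b")
          case False
          then show ?thesis
            using upper[OF lower[OF ib ab c(1)] il] \<open>b \<le> l\<close> lt by simp
        qed (use ab in simp)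
        then show ?thesis using exposes_t[OF v 2 vab ib] uib by blast
      qed
    next
      case c: 5
      have uaj: "exposes u a j" using exposes_self 4(1) u by blast
      consider "lookup v (RY j) > 0" | l where "lookup v (RT l j) > 0"
        using weight_RTI(2)[OF 4(1)] w weight_YD by metis
      then show ?thesis
      proof cases
        case 1
        then show ?thesis using exposes_y[OF v 1 vab aj] uaj by blast
      next
        case (2 l)
        have lj: "(l, j) \<in> E" using keysD[OF 2 v] by simp
        \<comment> \<open>Since j < b, minimality of a + b excludes l < a. The rules then give (a,
          l) and (l, b), so swapping t_ab t_lj in \<open>v\<close> yields t_aj.\<close>
        have "a \<le> l" using min[OF 2] c by linarith
        have "(l, b) \<in> E"
        proof (cases "l = a")
          case False
          then show ?thesis
            using upper[OF lower[OF aj lj] ab] \<open>a \<le> l\<close> edgeD[OF lj] c by simp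
        qed (use ab in simp)
        then show ?thesis using exposes_t[OF v vab 2 aj] uaj by blast
      qed
    qed
  qed
qed

text \<open>Splitting a common edge variable off both monomials lowers the exponent of
  \<open>T\<close> in the weight by one. The cofactors have equal weight again because
  \<open>weight\<close> is additive.\<close>

lemma rel_weight_eq:
  assumes "keys u \<subseteq> Rvars n E" "keys v \<subseteq> Rvars n E" "weight u = weight v"
  shows "rel u v"
  using assms
proof (induction "lookup (weight u) T" arbitrary: u v)
  case 0
  have no_RT: "lookup u (RT i j) = 0" "lookup v (RT i j) = 0" for i j
    using weight_RTI(3)[of u i j] weight_RTI(3)[of v i j] 0 by fastforce+
  have "lookup u s = lookup v s" for s
    using weight_no_RT[of u, OF no_RT(1)] weight_no_RT[of v, OF no_RT(2)] 0(4) no_RT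
    by (cases s) metis+
  then have "u = v" by (rule poly_mapping_eqI)
  then show ?case using rel_refl by simp
next
  case (Suc k)
  then obtain i j where "exposes u i j" "exposes v i j" using common_edge[of u v] by auto
  then obtain u' v' where ij: "(i, j) \<in> E" and u': "keys u' \<subseteq> Rvars n E" "rel u (t i j + u')"
    and v': "keys v' \<subseteq> Rvars n E" "rel v (t i j + v')" unfolding exposes_def by blast
  have wu: "weight u = weight (t i j + u')" and wv: "weight v = weight (t i j + v')"
    using u'(2) v'(2) by (auto simp: rel_def)
  then have "weight u' = weight v'" using Suc.prems(3) by (simp add: weight_add)
  moreover have "k = lookup (weight u') T"
    using Suc.hyps(2) wu by (simp add: weight_add lookup_add lookup_single when_def)
  ultimately have "rel u' v'" using Suc.hyps(1) u'(1) v'(1) by blast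
  then have "rel (t i j + u') (t i j + v')" using ij by (intro rel_add) auto
  then show ?case using u'(2) v'(2) rel_sym rel_trans by blast
qed

end

section \<open>Normal forms modulo L and the kernel of psi\<close>

context closed_edges
begin

lemma L_subset_ker: "L \<subseteq> ker_psi n E"
proof
  fix F assume "F \<in> L"
  then show "F \<in> ker_psi n E" unfolding L_def
    by (induction rule: ideal_gen.induct)
      (auto simp: ker_psi_def psi_simps R_ring_eq intro: polys_in_add polys_in_mult)
qed

text \<open>By \<open>rel_weight_eq\<close>, every term of top weight can be moved onto
  \<open>u\<close> with its coefficient unchanged, at the price of smaller terms. The sum
  \<open>c\<close> of these coefficients may vanish.\<close>

lemma combine_top_terms:
  assumes F: "F \<in> R_ring n E" and u: "keys u \<subseteq> Rvars n E"
    and top: "\<And>m. m \<in> keys F \<Longrightarrow> weight m = weight u \<or> tau_less (weight m) (weight u)"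
  shows "\<exists>c. \<exists>G\<in>R_ring n E. (\<forall>g\<in>keys G. tau_less (weight g) (weight u))
    \<and> F - Poly_Mapping.single u c - G \<in> L"
proof (induction F rule: mpoly_induct)
  case zero
  show ?case by (intro exI[of _ 0] bexI[of _ 0]) (simp_all add: L_props R_ring_eq)
next
  case (add F1 F2)
  then obtain c1 G1 c2 G2 where G: "G1 \<in> R_ring n E" "G2 \<in> R_ring n E"
    and less: "\<And>g. g \<in> keys G1 \<Longrightarrow> tau_less (weight g) (weight u)"
      "\<And>g. g \<in> keys G2 \<Longrightarrow> tau_less (weight g) (weight u)"
    and L: "F1 - Poly_Mapping.single u c1 - G1 \<in> L" "F2 - Poly_Mapping.single u c2 - G2 \<in> L"
    by blast
  have "F1 + F2 - Poly_Mapping.single u (c1 + c2) - (G1 + G2)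
      = (F1 - Poly_Mapping.single u c1 - G1) + (F2 - Poly_Mapping.single u c2 - G2)"
    by (simp add: single_add)
  then have "F1 + F2 - Poly_Mapping.single u (c1 + c2) - (G1 + G2) \<in> L"
    using L_props(2)[OF L] by (simp only:)
  moreover have "G1 + G2 \<in> R_ring n E" using G unfolding R_ring_eq by (rule polys_in_add)
  moreover have "\<forall>g\<in>keys (G1 + G2). tau_less (weight g) (weight u)"
    using keys_add[of G1 G2] less by blast
  ultimately show ?case by blast
next
  case (single m c)
  then have m: "keys m \<subseteq> Rvars n E" using F by (auto simp: R_ring_eq polys_in_iff)
  show ?case
  proof (cases "weight m = weight u")
    case True
    then obtain G where G: "G \<in> R_ring n E" "\<And>g. g \<in> keys G \<Longrightarrow> tau_less (weight g) (weight u)"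
        "mon m - mon u - G \<in> L"
      using rel_weight_eq[OF m u] unfolding rel_def by auto
    have c: "Const c \<in> R_ring n E" by (simp add: R_ring_eq)
    have "Poly_Mapping.single m c - Poly_Mapping.single u c - Const c * G = Const c * (mon m - mon u - G)"
      by (simp add: right_diff_distrib Const_mult_mono)
    then have "Poly_Mapping.single m c - Poly_Mapping.single u c - Const c * G \<in> L"
      using L_props(4)[OF c G(3)] by (simp only:)
    moreover have "Const c * G \<in> R_ring n E" using c G(1) unfolding R_ring_eq by (rule polys_in_mult)
    moreover have "\<forall>g\<in>keys (Const c * G). tau_less (weight g) (weight u)"
      using keys_mult[of "Const c" G] G(2) by (auto simp: Const_def split: if_splits)
    ultimately show ?thesis by blast
  next
    case False
    then have "tau_less (weight m) (weight u)" using top single by blast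
    moreover have "Poly_Mapping.single m c \<in> R_ring n E" using m by (simp add: R_ring_eq polys_in_single)
    ultimately show ?thesis
      by (intro exI[of _ 0] bexI[of _ "Poly_Mapping.single m c"]) (simp_all add: L_props)
  qed
qed

lemma weight_max:
  assumes "F \<noteq> 0"
  shows "\<exists>u\<in>keys F. \<forall>v\<in>keys F. weight v = weight u \<or> tau_less (weight v) (weight u)"
  using tau_max[of "weight ` keys F"] assms by fastforce

definition leading_form :: "(rvar, 'k) mpoly \<Rightarrow> (rvar \<Rightarrow>\<^sub>0 nat) \<Rightarrow> bool" where
  "leading_form F u \<longleftrightarrow> F \<in> R_ring n E \<and> u \<in> keys F
     \<and> (\<forall>v\<in>keys F. v \<noteq> u \<longrightarrow> tau_less (weight v) (weight u))"

text \<open>Descent on the top weight. If the collected coefficient is 0, the remainder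
  \<open>G\<close> has smaller top weight and takes over; otherwise \<open>u\<close> has become the
  unique top monomial.\<close>

lemma normal_form_aux:
  assumes "F \<in> R_ring n E" "u \<in> keys F" "\<forall>v\<in>keys F. weight v = weight u \<or> tau_less (weight v) (weight u)"
  shows "F \<in> L \<or> (\<exists>F' u'. leading_form F' u' \<and> F - F' \<in> L)"
  using assms
proof (induction "weight u" arbitrary: F u rule: wf_induct_rule[OF tau_wf[of n]])
  case (1 u F)
  have u: "keys u \<subseteq> Rvars n E" using 1(2,3) by (auto simp: R_ring_eq polys_in_iff)
  obtain c G where G: "G \<in> R_ring n E" "\<And>g. g \<in> keys G \<Longrightarrow> tau_less (weight g) (weight u)"
      and FG: "F - Poly_Mapping.single u c - G \<in> L"
    using combine_top_terms[OF 1(2) u] 1(4) by blast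
  show ?case
  proof (cases "c = 0")
    case True
    then have FG: "F - G \<in> L" using FG by simp
    show ?thesis
    proof (cases "G = 0")
      case True
      then show ?thesis using FG by simp
    next
      case False
      then obtain v where v: "v \<in> keys G" "\<forall>w\<in>keys G. weight w = weight v \<or> tau_less (weight w) (weight v)"
        using weight_max by blast
      have "keys v \<subseteq> Rvars n E" using v(1) G(1) by (auto simp: R_ring_eq polys_in_iff)
      then have "(weight v, weight u) \<in> {(a, b). tau_less a b \<and> keys a \<subseteq> Tvars n \<and> keys b \<subseteq> Tvars n}"
        using G(2)[OF v(1)] keys_weight[OF _ E] u by simp
      then consider "G \<in> L" | F' u' where "leading_form F' u'" "G - F' \<in> L"
        using 1(1) G(1) v by blast
      then show ?thesis
      proof cases
        case 1
        then have "(F - G) + G \<in> L" using FG L_props(2) by blast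
        then show ?thesis by simp
      next
        case (2 F' u')
        then have "(F - G) + (G - F') \<in> L" using FG L_props(2) by blast
        then show ?thesis using 2(1) by auto
      qed
    qed
  next
    case False
    have "u \<notin> keys G" using G(2) tau_irrefl by blast
    have "leading_form (Poly_Mapping.single u c + G) u"
      unfolding leading_form_def
    proof (intro conjI ballI impI)
      show "Poly_Mapping.single u c + G \<in> R_ring n E"
        using G(1) u unfolding R_ring_eq by (intro polys_in_add polys_in_single)
      show "u \<in> keys (Poly_Mapping.single u c + G)"
        using False \<open>u \<notin> keys G\<close> by (simp add: in_keys_iff lookup_add)
      show "tau_less (weight v) (weight u)"
        if "v \<in> keys (Poly_Mapping.single u c + G)" "v \<noteq> u" for v
        using that keys_add[of "Poly_Mapping.single u c" G] G(2) False by auto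
    qed
    moreover have "F - (Poly_Mapping.single u c + G) \<in> L" using FG by (simp add: algebra_simps)
    ultimately show ?thesis by blast
  qed
qed

lemma normal_form:
  assumes "F \<in> R_ring n E"
  shows "F \<in> L \<or> (\<exists>F' u. leading_form F' u \<and> F - F' \<in> L)"
proof (cases "F = 0")
  case True
  then show ?thesis using L_props(1) by simp
next
  case False
  then show ?thesis using weight_max normal_form_aux[OF assms] by blast
qed

text \<open>As \<open>psi\<close> kills \<open>L\<close>, it gives \<open>F\<close> and its normal
  form the same image. Applied to kernel elements this yields \<open>ker_psi_eq_L\<close>, applied
  to preimages of Rees algebra elements it yields the Sagbi property.\<close>

lemma is_lm_psi_or_L:
  assumes "F \<in> R_ring n E"
  shows "F \<in> L \<or> (\<exists>u. keys u \<subseteq> Rvars n E \<and> is_lm (psi F) (weight u))"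
proof (cases "F \<in> L")
  case False
  then obtain F' u where F': "leading_form F' u" "F - F' \<in> L" using normal_form[OF assms] by blast
  have "psi (F - F') = 0" using F'(2) L_subset_ker by (auto simp: ker_psi_def)
  then have "psi F = psi F'" by (simp add: psi_simps)
  moreover have "is_lm (psi F') (weight u)"
    using F'(1) E unfolding leading_form_def by (intro is_lm_psi) auto
  moreover have "keys u \<subseteq> Rvars n E"
    using F'(1) by (auto simp: leading_form_def R_ring_eq polys_in_iff)
  ultimately show ?thesis by auto
qed simp

lemma ker_psi_eq_L: "ker_psi n E = L"
proof
  show "ker_psi n E \<subseteq> L"
  proof
    fix F :: "(rvar, 'k) mpoly" assume "F \<in> ker_psi n E"
    then have "F \<in> R_ring n E" "psi F = 0" by (auto simp: ker_psi_def)
    then show "F \<in> L" using is_lm_psi_or_L[of F] by (auto simp: is_lm_def)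
  qed
qed (rule L_subset_ker)

end

section \<open>The relation type\<close>

definition trunc :: "nat \<Rightarrow> (rvar, 'k::comm_ring_1) mpoly \<Rightarrow> (rvar, 'k) mpoly" where
  "trunc d F = Abs_poly_mapping (\<lambda>m. if R_tdeg m \<le> d then lookup F m else 0)"

lemma lookup_trunc: "lookup (trunc d F) m = (if R_tdeg m \<le> d then lookup F m else 0)"
proof -
  have "{m. (if R_tdeg m \<le> d then lookup F m else 0) \<noteq> 0} \<subseteq> keys F"
    by (auto simp: in_keys_iff split: if_splits)
  then have "finite {m. (if R_tdeg m \<le> d then lookup F m else 0) \<noteq> 0}"
    by (rule finite_subset) simp
  then show ?thesis unfolding trunc_def by simp
qed

lemma trunc_simps:
  "trunc d 0 = 0" "trunc d (F + G) = trunc d F + trunc d G"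
  "trunc d (Poly_Mapping.single m c) = (if R_tdeg m \<le> d then Poly_Mapping.single m c else 0)"
  by (rule poly_mapping_eqI, auto simp: lookup_trunc lookup_add lookup_single when_def)+

lemma trunc_id: "(\<And>m. m \<in> keys F \<Longrightarrow> R_tdeg m \<le> d) \<Longrightarrow> trunc d F = F"
  by (rule poly_mapping_eqI) (auto simp: lookup_trunc in_keys_iff)

lemma trunc_eq_0: "(\<And>m. m \<in> keys F \<Longrightarrow> d < R_tdeg m) \<Longrightarrow> trunc d F = 0"
  by (rule poly_mapping_eqI) (fastforce simp: lookup_trunc in_keys_iff)

text \<open>Multiplying by one term shifts the \<open>t\<close>-degree by \<open>R_tdeg m\<close>,
  so the bound drops by that amount. The case distinction keeps the natural subtraction
  honest.\<close>

lemma trunc_single_mult: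
  "trunc d (Poly_Mapping.single m c * F)
    = (if R_tdeg m \<le> d then Poly_Mapping.single m c * trunc (d - R_tdeg m) F else 0)"
proof (induction F rule: mpoly_induct)
  case (single m' c')
  then show ?case by (auto simp: mult_single trunc_simps R_tdeg_add)
qed (simp_all add: trunc_simps distrib_left)

text \<open>
  A generator of \<open>t\<close>-degree above \<open>D\<close> cannot contribute in \<open>t\<close>-degree at most \<open>D\<close>.
\<close>

lemma trunc_ideal_remove:
  fixes Gs :: "(rvar, 'k::comm_ring_1) mpoly set"
  assumes hom: "\<And>h. h \<in> Gs \<Longrightarrow> bihomogeneous h"
    and g: "\<And>m. m \<in> keys g \<Longrightarrow> D < R_tdeg m"
    and F: "F \<in> ideal_gen (R_ring n E) Gs" and "d \<le> D"
  shows "trunc d F \<in> ideal_gen (R_ring n E) (Gs - {g})"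
  using F \<open>d \<le> D\<close>
proof (induction arbitrary: d rule: ideal_gen.induct)
  case zero
  then show ?case by (simp add: trunc_simps ideal_gen.zero)
next
  case (gen b)
  obtain e where e: "\<And>m. m \<in> keys b \<Longrightarrow> R_tdeg m = e"
    using hom[OF gen(1)] unfolding bihomogeneous_def by blast
  show ?case
  \<comment> \<open>A generator homogeneous in \<open>t\<close> is truncated to itself or to 0, and
    \<open>g\<close> always to 0.\<close>
  proof (cases "b = g \<or> d < e")
    case True
    then have "trunc d b = 0" using g gen(2) e by (intro trunc_eq_0) fastforce
    then show ?thesis by (simp add: ideal_gen.zero)
  next
    case False
    then have "trunc d b = b" using e by (intro trunc_id) auto
    then show ?thesis using False gen(1) by (simp add: ideal_gen.gen)
  qed
next
  case (add a c)
  then show ?case by (simp add: trunc_simps ideal_gen.add)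
next
  \<comment> \<open>Truncation passes through a product only for single terms, so \<open>r\<close>
    is split into terms and the hypothesis on \<open>a\<close> is used at the lowered bound.\<close>
  case (mult r a)
  show ?case
  proof (induction r rule: mpoly_induct)
    case zero
    then show ?case by (simp add: trunc_simps ideal_gen.zero)
  next
    case (add r s)
    then show ?case by (simp add: trunc_simps distrib_right ideal_gen.add)
  next
    case (single m c)
    then have "Poly_Mapping.single m c \<in> R_ring n E"
      using mult.hyps(1) unfolding R_ring_eq polys_in_iff by (auto split: if_splits)
    then show ?case
      using mult.IH[of "d - R_tdeg m"] mult.prems
      by (simp add: trunc_single_mult ideal_gen.zero ideal_gen.mult)
  qed
qed

text \<open>Truncation at 2 fixes the generators of \<open>L\<close>. If \<open>g\<close> lived in
  larger \<open>t\<close>-degree, they would all be generated by \<open>Gs - {g}\<close>, and since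
  \<open>L\<close> is the whole kernel, \<open>g\<close> would be redundant.\<close>

lemma (in closed_edges) relation_type_le_2: "relation_type_le n E TYPE('k) 2"
  unfolding relation_type_le_def
proof (intro allI impI ballI)
  fix Gs :: "(rvar, 'k) mpoly set" and g m
  assume min: "minimal_generators n E Gs" and g: "g \<in> Gs" "m \<in> keys g"
  then have hom: "\<And>h. h \<in> Gs \<Longrightarrow> bihomogeneous h" and gen: "ideal_gen (R_ring n E) Gs = ker_psi n E"
    and irred: "ideal_gen (R_ring n E) (Gs - {g}) \<noteq> ker_psi n E"
    unfolding minimal_generators_def by blast+
  show "R_tdeg m \<le> 2"
  proof (rule ccontr)
    assume "\<not> R_tdeg m \<le> 2"
    \<comment> \<open>Bihomogeneity carries the degree of the single monomial \<open>m\<close> over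
      to all monomials of \<open>g\<close>.\<close>
    then have big: "2 < R_tdeg m'" if "m' \<in> keys g" for m'
      using hom[OF g(1)] g(2) that unfolding bihomogeneous_def by force
    have "{F \<in> ker_psi n E. \<forall>m\<in>keys F. R_tdeg m \<le> 2} \<subseteq> ideal_gen (R_ring n E) (Gs - {g})"
    proof clarify
      fix F :: "(rvar, 'k) mpoly" assume F: "F \<in> ker_psi n E" "\<forall>m\<in>keys F. R_tdeg m \<le> 2"
      have "trunc 2 F \<in> ideal_gen (R_ring n E) (Gs - {g})"
        by (rule trunc_ideal_remove[OF hom big]) (use F(1) gen in simp_all)
      then show "F \<in> ideal_gen (R_ring n E) (Gs - {g})" using F(2) trunc_id[of F 2] by simp
    qed
    then have "L \<subseteq> ideal_gen (R_ring n E) (Gs - {g})"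
      unfolding L_def by (rule ideal_gen_subset)
    then have "ker_psi n E \<subseteq> ideal_gen (R_ring n E) (Gs - {g})"
      unfolding ker_psi_eq_L .
    moreover have "ideal_gen (R_ring n E) (Gs - {g}) \<subseteq> ker_psi n E"
      unfolding gen[symmetric] by (rule ideal_gen_mono) auto
    ultimately show False using irred by blast
  qed
qed

section \<open>The Sagbi basis\<close>

definition sagbi_gens :: "nat \<Rightarrow> (nat \<times> nat) set \<Rightarrow> (var, 'k::comm_ring_1) mpoly set" where
  "sagbi_gens n E = (\<lambda>i. Var (X i)) ` {1..n} \<union> (\<lambda>i. Var (Y i)) ` {1..n} \<union> (\<lambda>e. f_edge e * Var T) ` E"

lemma sagbi_gens_eq: "(sagbi_gens n E :: (var, 'k::comm_ring_1) mpoly set) = psi_img ` Rvars n E"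
proof -
  have "(\<lambda>e. f_edge e * Var T) ` E = (psi_img ` (\<lambda>(i, j). RT i j) ` E :: (var, 'k) mpoly set)"
    unfolding image_image by (rule image_cong) auto
  then show ?thesis
    unfolding sagbi_gens_def Rvars_def image_Un by (simp add: image_image)
qed

lemma init_psi_img:
  assumes "graph_on n E" "v \<in> Rvars n E"
  shows "init tau_less (psi_img v :: (var, 'k::comm_ring_1) mpoly) = mon (wvar v)" "psi_img v \<noteq> (0 :: (var, 'k) mpoly)"
proof -
  have "monic_lm (monsub psi_img (Poly_Mapping.single v 1) :: (var, 'k) mpoly) (weight (Poly_Mapping.single v 1))"
    using assms by (intro monic_lm_monsub) auto
  then have "monic_lm (psi_img v :: (var, 'k) mpoly) (wvar v)" by simp
  then show "init tau_less (psi_img v :: (var, 'k) mpoly) = mon (wvar v)" "psi_img v \<noteq> (0 :: (var, 'k) mpoly)"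
    by (auto simp: init_tau[OF monic_lm_is_lm] monic_lm_def)
qed

text \<open>The image of \<open>psi\<close> is an algebra containing the generators, so every
  element of the Rees algebra has a preimage to which the normal form applies.\<close>

lemma alg_gen_subset_psi_image:
  "alg_gen (psi_img ` Rvars n E) \<subseteq> psi ` (R_ring n E :: (rvar, 'k::comm_ring_1) mpoly set)"
proof
  fix f :: "(var, 'k) mpoly" assume "f \<in> alg_gen (psi_img ` Rvars n E)"
  then show "f \<in> psi ` (R_ring n E)"
  proof (induction rule: alg_gen.induct)
    case (const c)
    then show ?case by (intro image_eqI[of _ _ "Const c"]) (simp_all add: psi_simps R_ring_eq)
  next
    case (gen b)
    then obtain v where "v \<in> Rvars n E" "b = psi_img v" by blast
    then show ?case by (intro image_eqI[of _ _ "Var v"]) (simp_all add: psi_simps R_ring_eq polys_in_Var)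
  next
    case (add a c)
    then obtain F G where "F \<in> R_ring n E" "G \<in> R_ring n E" "a = psi F" "c = psi G" by blast
    then show ?case by (intro image_eqI[of _ _ "F + G"]) (simp_all add: psi_simps R_ring_eq polys_in_add)
  next
    case (mult a c)
    then obtain F G where FG: "F \<in> R_ring n E" "G \<in> R_ring n E" "a = psi F" "c = psi G" by blast
    then have "F * G \<in> R_ring n E" unfolding R_ring_eq by (intro polys_in_mult)
    then show ?case using FG(3,4) by (intro image_eqI[of _ _ "F * G"]) (simp_all add: psi_simps)
  qed
qed

lemma mon_weight_in_alg_gen:
  assumes "keys u \<subseteq> V" shows "(mon (weight u) :: (var, 'k::comm_ring_1) mpoly) \<in> alg_gen ((\<lambda>v. mon (wvar v)) ` V)"
proof (induction u rule: monomial_induct)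
  case zero
  then show ?case by (simp add: alg_gen_1)
next
  case (add v u')
  have "(mon (wvar v) :: (var, 'k) mpoly) \<in> (\<lambda>v. mon (wvar v)) ` V" using add.hyps assms by blast
  then have "(mon (wvar v) * mon (weight u') :: (var, 'k) mpoly) \<in> alg_gen ((\<lambda>v. mon (wvar v)) ` V)"
    by (intro alg_gen.mult alg_gen.gen add.IH)
  then show ?case by (simp add: weight_add mult_single)
qed

theorem mainTheorem5:
  fixes n :: nat and E :: "(nat \<times> nat) set"
  assumes "graph_on n E"
    and "closed_graph TYPE('k::field) n E"
  shows "init_alg tau_less (rees n (J_G n E :: (var, 'k) mpoly set))
           = rees n (init_ideal sigma_less (S_ring n) (J_G n E :: (var, 'k) mpoly set))
         \<and> relation_type_le n E TYPE('k) 2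
         \<and> is_sagbi_basis tau_less (rees n (J_G n E :: (var, 'k) mpoly set))
             ((\<lambda>i. Var (X i)) ` {1..n} \<union> (\<lambda>i. Var (Y i)) ` {1..n} \<union> (\<lambda>e. f_edge e * Var T) ` E)"
proof -
  interpret closed_edges n E
    "ideal_gen (R_ring n E) {F \<in> ker_psi n E. \<forall>m\<in>keys F. R_tdeg m \<le> 2} :: (rvar, 'k) mpoly set"
    by unfold_locales (rule assms(1), erule (2) closed_graph_upper[OF assms], erule (2) closed_graph_lower[OF assms], rule refl)
  let ?J = "J_G n E :: (var, 'k) mpoly set"
  let ?inJ = "init_ideal sigma_less (S_ring n) ?J"
  let ?gens = "sagbi_gens n E :: (var, 'k) mpoly set"
  let ?inB = "(\<lambda>v. mon (wvar v)) ` Rvars n E :: (var, 'k) mpoly set"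
  have fS: "f_edge e \<in> (S_ring n :: (var, 'k) mpoly set)" if "e \<in> E" for e
    using that edgeD[of "fst e" "snd e"] f_edge_in_S_ring[of "fst e" "snd e" n] by simp
  have init_f: "init sigma_less (f_edge e) = (Var (X (fst e)) * Var (Y (snd e)) :: (var, 'k) mpoly)" if "e \<in> E" for e
    using that edgeD[of "fst e" "snd e"] init_sigma_f_edge[of "fst e" "snd e" n] by simp
  interpret J: S_ideal n "f_edge ` E" ?J
    using fS by unfold_locales (auto simp: J_G_def)
  \<comment> \<open>Closedness says precisely that the initial terms of the edge binomials generate
    the initial ideal, so its Rees algebra is an instance of the same locale.\<close>
  interpret I0: S_ideal n "init sigma_less ` f_edge ` E" ?inJ
  proof
    show "init sigma_less ` f_edge ` E \<subseteq> (S_ring n :: (var, 'k) mpoly set)"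
    proof (clarify)
      fix i j assume ij: "(i, j) \<in> E"
      have "Var (X i) * Var (Y j) \<in> (S_ring n :: (var, 'k) mpoly set)"
        using edgeD[OF ij] unfolding S_ring_def by (intro polys_in_mult polys_in_Var) (auto simp: S_vars_def)
      then show "init sigma_less (f_edge (i, j)) \<in> (S_ring n :: (var, 'k) mpoly set)"
        using init_f[OF ij] by simp
    qed
    show "?inJ = ideal_gen (S_ring n) (init sigma_less ` f_edge ` E)"
      using assms(2) by (simp add: closed_graph_def is_groebner_basis_def J_G_def)
  qed
  have Var_S: "Var v \<in> (S_ring n :: (var, 'k) mpoly set)" if "v \<in> S_vars n" for v
    using that by (simp add: S_ring_def polys_in_Var)
  have B_rees: "?gens \<subseteq> rees n ?J"
  proof -
    have "psi_img v \<in> rees n ?J" if v: "v \<in> Rvars n E" for v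
    proof (cases v)
      case (RT i j)
      then have "(i, j) \<in> E" using v by simp
      then show ?thesis using J.gen_mult_T_in_rees[OF imageI] RT by simp
    next
      case (RX i)
      then have "X i \<in> S_vars n" using v by (simp add: S_vars_def)
      then show ?thesis using RX subsetD[OF J.S_ring_subset_rees Var_S] by simp
    next
      case (RY i)
      then have "Y i \<in> S_vars n" using v by (simp add: S_vars_def)
      then show ?thesis using RY subsetD[OF J.S_ring_subset_rees Var_S] by simp
    qed
    then show ?thesis unfolding sagbi_gens_eq by (rule image_subsetI)
  qed
  have init_B: "init tau_less ` ?gens = ?inB"
    unfolding sagbi_gens_eq image_image using init_psi_img(1)[OF assms(1)] by (intro image_cong) auto
  have B0_alg: "Var ` S_vars n \<subseteq> alg_gen ?inB"
  proof (clarify intro!: alg_gen.gen)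
    fix v assume v: "v \<in> S_vars n"
    then consider i where "i \<in> {1..n}" "v = X i" | i where "i \<in> {1..n}" "v = Y i"
      by (auto simp: S_vars_def)
    then show "Var v \<in> ?inB"
    proof cases
      case (1 i)
      then show ?thesis by (intro image_eqI[of _ _ "RX i"]) (simp_all add: Var_def)
    next
      case (2 i)
      then show ?thesis by (intro image_eqI[of _ _ "RY i"]) (simp_all add: Var_def)
    qed
  qed
  have in_gen_T: "init sigma_less (f_edge e) * Var T = (mon (wvar (RT (fst e) (snd e))) :: (var, 'k) mpoly)"
    if "e \<in> E" for e
    using init_f[OF that] by (simp add: Var_def mult_single add.assoc)
  have rees_I0: "alg_gen ?inB = rees n ?inJ"
  proof
    show "rees n ?inJ \<subseteq> alg_gen ?inB"
    proof (rule I0.rees_subset_alg_gen[OF B0_alg])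
      fix g :: "(var, 'k) mpoly" assume "g \<in> init sigma_less ` f_edge ` E"
      then obtain e where e: "e \<in> E" "g = init sigma_less (f_edge e)" by blast
      then have "g * Var T = (mon (wvar (RT (fst e) (snd e))) :: (var, 'k) mpoly)" using in_gen_T[OF e(1)] by simp
      moreover have "RT (fst e) (snd e) \<in> Rvars n E" using e(1) by simp
      ultimately have "g * Var T \<in> ?inB" by (rule image_eqI)
      then show "g * Var T \<in> alg_gen ?inB" by (rule alg_gen.gen)
    qed
    have "mon (wvar v) \<in> rees n ?inJ" if "v \<in> Rvars n E" for v
    proof (cases v)
      case (RT i j)
      then have ij: "(i, j) \<in> E" using that by simp
      then show ?thesis using I0.gen_mult_T_in_rees[OF imageI[OF imageI[OF ij]]] in_gen_T[OF ij] RT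
        by simp
    next
      case (RX i)
      then have "X i \<in> S_vars n" using that by (simp add: S_vars_def)
      then show ?thesis using RX subsetD[OF I0.S_ring_subset_rees Var_S] by (simp add: Var_def)
    next
      case (RY i)
      then have "Y i \<in> S_vars n" using that by (simp add: S_vars_def)
      then show ?thesis using RY subsetD[OF I0.S_ring_subset_rees Var_S] by (simp add: Var_def)
    qed
    then show "alg_gen ?inB \<subseteq> rees n ?inJ" by (intro I0.alg_gen_subset_rees image_subsetI)
  qed
  have rees_J: "rees n ?J \<subseteq> alg_gen ?gens"
  proof (rule J.rees_subset_alg_gen)
    show "Var ` S_vars n \<subseteq> alg_gen ?gens"
      unfolding sagbi_gens_def S_vars_def by (intro image_subsetI alg_gen.gen) blast
    show "g * Var T \<in> alg_gen ?gens" if "g \<in> f_edge ` E" for g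
      using that unfolding sagbi_gens_def by (intro alg_gen.gen) blast
  qed
  have init_alg: "init_alg tau_less (rees n ?J) = alg_gen ?inB"
  proof
    show "init_alg tau_less (rees n ?J) \<subseteq> alg_gen ?inB"
      unfolding init_alg_def
    proof (intro alg_gen_mono subsetI)
      fix p assume "p \<in> {init tau_less f |f. f \<in> rees n ?J \<and> f \<noteq> 0}"
      then obtain f where f: "p = init tau_less f" "f \<in> rees n ?J" "f \<noteq> 0" by blast
      then have "f \<in> psi ` (R_ring n E)"
        using rees_J alg_gen_subset_psi_image[of n E] unfolding sagbi_gens_eq by blast
      then obtain F where F: "F \<in> R_ring n E" "f = psi F" by blast
      \<comment> \<open>The ideal \<open>L\<close> lies in the kernel while \<open>psi F = f\<close>
        is nonzero; hence the leading monomial of \<open>f\<close> is the weight of a monomial of R,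
        a product of the \<open>wvar v\<close>.\<close>
      then have "F \<notin> ideal_gen (R_ring n E) {F \<in> ker_psi n E. \<forall>m\<in>keys F. R_tdeg m \<le> 2}"
        using f(3) L_subset_ker by (auto simp: ker_psi_def)
      then obtain u where u: "keys u \<subseteq> Rvars n E" "is_lm f (weight u)"
        using is_lm_psi_or_L[OF F(1)] F(2) by blast
      have "p = Const (lookup f (weight u)) * mon (weight u)"
        using f(1) init_tau[OF u(2)] by (simp only: Const_mult_mono)
      then show "p \<in> alg_gen ?inB"
        using alg_gen.mult[OF alg_gen.const mon_weight_in_alg_gen[OF u(1)]] by simp
    qed
    show "alg_gen ?inB \<subseteq> init_alg tau_less (rees n ?J)"
      unfolding init_alg_def
    proof (intro alg_gen_mono subsetI)
      fix p assume "p \<in> ?inB"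
      then obtain v where v: "v \<in> Rvars n E" "p = mon (wvar v)" by blast
      then have "p = init tau_less (psi_img v)" "psi_img v \<in> rees n ?J" "psi_img v \<noteq> (0 :: (var, 'k) mpoly)"
        using init_psi_img[OF assms(1) v(1), where 'k = 'k] B_rees unfolding sagbi_gens_eq by auto
      then have "p \<in> {init tau_less f |f. f \<in> rees n ?J \<and> f \<noteq> 0}" by blast
      then show "p \<in> alg_gen {init tau_less f |f. f \<in> rees n ?J \<and> f \<noteq> 0}" by (rule alg_gen.gen)
    qed
  qed
  have "is_sagbi_basis tau_less (rees n ?J) ?gens"
    unfolding is_sagbi_basis_def using B_rees init_B init_alg by simp
  then show ?thesis
    using init_alg rees_I0 relation_type_le_2 unfolding sagbi_gens_def by simp
qed

end
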